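(* Let $p$ be an odd prime, $m$ a positive even integer, $s=m/2$, $q=p^m$, $u$ a positive integer and $v=\gcd(m,u)$. Let $\mathrm{Tr}$ denote the trace map from $\mathbb{F}_q$ to $\mathbb{F}_p$. Let \[ D_1=\{(x,y)\in\mathbb{F}_q^2\setminus\{(0,0)\} : \mathrm{Tr}(x+y^{p^u+1})=0\}, \] and $C_{D_1}=\{c(a,b)=(\mathrm{Tr}(ax+by))_{(x,y)\in D_1} : a,b\in\mathbb{F}_q\}$. If $\frac{m}{v}\equiv 0\pmod 4$, then $C_{D_1}$ is a $[p^{2m-1}-1,2m]$ three-weight linear code over $\mathbb{F}_p$ whose weight distribution is: weight $0$ with multiplicity $1$; weight $(p-1)p^{2m-2}$ with multiplicity $p^{2m}-1-(p-1)p^{m-2v}$; weight $(p-1)p^{2m-2}\left(1+\frac{1}{p^{s-v}}\right)$ with multiplicity $(p-1)(p^{m-2v-1}-p^{s-v}+p^{s-v-1})$; and weight $(p-1)p^{2m-2}\left(1-\frac{1}{(p-1)p^{s-v}}\right)$ with multiplicity $(p-1)(p^{s-v}+1)(p^{s-v}-p^{s-v-1})$.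
   Context: An $[n,k]$ linear code over $\mathbb{F}_p$ is a $k$-dimensional subspace of $\mathbb{F}_p^n$. The multiplicity of a weight $w$ is the number of codewords of Hamming weight $w$; a code is $t$-weight if exactly $t$ nonzero weights occur. *)

theory Defs
  imports Complex_Main "HOL-Library.Cardinality" "HOL-Computational_Algebra.Primes"
begin

text \<open>Finite field F_q is modelled as a finite field type 'a with CARD('a) = q = p^m.
  The absolute trace Tr : F_q -> F_p, Tr(x) = sum_{i<m} x^(p^i); its values lie in the
  prime subfield, which we view inside 'a.\<close>

definition tr :: "nat \<Rightarrow> nat \<Rightarrow> 'a::field \<Rightarrow> 'a" where
  "tr p m x = (\<Sum>i<m. x ^ (p ^ i))"

definition D1 :: "nat \<Rightarrow> nat \<Rightarrow> nat \<Rightarrow> ('a::{field,finite} \<times> 'a) set" where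
  "D1 p m u = {(x, y). (x, y) \<noteq> (0, 0) \<and> tr p m (x + y ^ (p ^ u + 1)) = 0}"

text \<open>The codeword c(a,b), as a vector indexed by D_1 (extended by 0 outside D_1).\<close>
definition cw :: "nat \<Rightarrow> nat \<Rightarrow> nat \<Rightarrow> 'a::{field,finite} \<Rightarrow> 'a \<Rightarrow> ('a \<times> 'a \<Rightarrow> 'a)" where
  "cw p m u a b = (\<lambda>(x, y). if (x, y) \<in> D1 p m u then tr p m (a * x + b * y) else 0)"

definition code :: "nat \<Rightarrow> nat \<Rightarrow> nat \<Rightarrow> ('a::{field,finite} \<times> 'a \<Rightarrow> 'a) set" where
  "code p m u = {cw p m u a b | a b. True}"

definition hwt :: "nat \<Rightarrow> nat \<Rightarrow> nat \<Rightarrow> ('a::{field,finite} \<times> 'a \<Rightarrow> 'a) \<Rightarrow> nat" where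
  "hwt p m u c = card {z \<in> D1 p m u. c z \<noteq> 0}"

definition wmult :: "nat \<Rightarrow> nat \<Rightarrow> nat \<Rightarrow> ('a::{field,finite}) itself \<Rightarrow> nat \<Rightarrow> nat" where
  "wmult p m u T w =
     card {c \<in> (code p m u :: ('a \<times> 'a \<Rightarrow> 'a) set). hwt p m u c = w}"

end

theory Submission
  imports Defs "HOL-Computational_Algebra.Polynomial"
begin

text \<open>
  Put \<open>Q y = Tr (y ^ (p ^ u + 1))\<close>. For \<open>(a, b) \<noteq> (0, 0)\<close> with \<open>a\<close> not a nonzero element of the prime field, the
  two conditions \<open>Tr x + Q y = 0\<close> and \<open>Tr (a x + b y) = 0\<close> are independent; otherwise the weight of
  \<open>c(a, b)\<close> is determined by the number of solutions of \<open>Q y = Tr (b / a y)\<close>. The radical of \<open>Q\<close> has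
  \<open>p ^ (2 v)\<close> elements; if \<open>Tr (b / a y)\<close> does not vanish on it all values of \<open>Q y - Tr (b / a y)\<close>
  are equally frequent, and otherwise completing the square reduces to counting a level set of \<open>Q\<close>.

  The sizes of the level sets are found without character sums. The nonzero ones are equinumerous
  because every nonzero element of the prime field is a \<open>(p ^ u + 1)\<close>-th power; counting the pairs
  with \<open>Q y = Q z\<close> then determines their size up to a sign, and the sign follows from divisibility
  by \<open>p ^ v + 1\<close>, as the \<open>(p ^ v + 1)\<close>-th roots of unity act freely on each of them.
\<close>

section \<open>Fibre counts, power maps and elementary divisibility\<close>

lemma card_eq_sum_card_fibres:
  assumes "finite A" "finite B" "f ` A \<subseteq> B"
  shows "card A = (\<Sum>b\<in>B. card {a \<in> A. f a = b})"
proof -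
  have "card A = card (\<Union>b\<in>B. {a \<in> A. f a = b})"
    using assms(3) by (intro arg_cong[of _ _ card]) auto
  also have "\<dots> = (\<Sum>b\<in>B. card {a \<in> A. f a = b})"
    by (rule card_UN_disjoint) (use assms in auto)
  finally show ?thesis .
qed

text \<open>A single fibre below \<open>d\<close> would push the total below \<open>d * e\<close>.
  This turns upper bounds on numbers of polynomial roots into exact counts.\<close>

lemma card_fibre_eq_of_bounds:
  assumes "finite A" "finite B" "f ` A \<subseteq> B" "b \<in> B"
    and le: "\<And>b. b \<in> B \<Longrightarrow> card {a \<in> A. f a = b} \<le> d"
    and "card B \<le> e" "card A = d * e"
  shows "card {a \<in> A. f a = b} = d"
proof (rule ccontr)
  assume "card {a \<in> A. f a = b} \<noteq> d"
  with le[OF \<open>b \<in> B\<close>] have less: "card {a \<in> A. f a = b} < d" by simp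
  have "card A < (\<Sum>b\<in>B. d)"
    unfolding card_eq_sum_card_fibres[OF assms(1-3)]
    by (rule sum_strict_mono_ex1) (use assms less in auto)
  also have "\<dots> \<le> d * e" using \<open>card B \<le> e\<close> by simp
  finally show False using \<open>card A = d * e\<close> by simp
qed

lemma card_power_eq_le:
  fixes b :: "'a::{field,finite}"
  assumes "d > 0"
  shows "card {x. x ^ d = b} \<le> d"
proof -
  let ?P = "monom 1 d - [:b:]"
  have "coeff ?P d = 1" using assms by (simp add: coeff_pCons split: nat.splits)
  hence nz: "?P \<noteq> 0" by (metis coeff_0 zero_neq_one)
  have "degree ?P \<le> d" by (intro degree_diff_le) (auto simp: degree_monom_le)
  moreover have "{x. x ^ d = b} = {x. poly ?P x = 0}" by (auto simp: poly_monom)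
  ultimately show ?thesis using card_poly_roots_bound[OF nz] by simp
qed

lemma finite_field_power_card_minus_1:
  fixes x :: "'a::{field,finite}"
  assumes "x \<noteq> 0"
  shows "x ^ (CARD('a) - 1) = 1"
proof -
  have "(\<Prod>y\<in>UNIV-{0}. x * y) = (\<Prod>y\<in>UNIV-{0}. y)"
    by (rule prod.reindex_bij_witness[of _ "\<lambda>y. y / x" "\<lambda>y. x * y"]) (use assms in auto)
  moreover have "(\<Prod>y\<in>UNIV-{0}. x * y) = x ^ (CARD('a) - 1) * (\<Prod>y\<in>UNIV-{0}. y)"
    by (simp add: prod.distrib card_Diff_singleton)
  ultimately show ?thesis by simp
qed

text \<open>The \<open>d\<close>-th power map sends the \<open>d * e\<close> nonzero elements into
  the at most \<open>e\<close> roots of \<open>z ^ e = 1\<close>, with fibres of size at most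
  \<open>d\<close>, so both bounds are attained. This yields \<open>d\<close>-th roots without
  appeal to the cyclicity of the multiplicative group.\<close>

lemma card_power_eq:
  fixes b :: "'a::{field,finite}"
  assumes "CARD('a) - 1 = d * e" "b ^ e = 1"
  shows "card {x. x ^ d = b} = d"
proof -
  have "CARD('a) > 1" using card_mono[of UNIV "{0, 1::'a}"] by simp
  hence pos: "d > 0" "e > 0" using assms(1) by (auto intro!: Nat.gr0I)
  have "card {x \<in> UNIV - {0}. x ^ d = b} = d"
  proof (rule card_fibre_eq_of_bounds)
    show "(\<lambda>x. x ^ d) ` (UNIV - {0::'a}) \<subseteq> {z. z ^ e = 1}"
      using finite_field_power_card_minus_1[where 'a = 'a] unfolding assms(1)
      by (auto simp flip: power_mult)
    show "card {z::'a. z ^ e = 1} \<le> e" by (rule card_power_eq_le) fact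
    show "card (UNIV - {0::'a}) = d * e" using assms(1) by (simp add: card_Diff_singleton)
    show "card {a \<in> UNIV - {0}. a ^ d = b} \<le> d" for b :: 'a
      by (rule order.trans[OF card_mono card_power_eq_le[OF pos(1), of b]]) auto
  qed (use assms in auto)
  moreover have "{x \<in> UNIV - {0}. x ^ d = b} = {x. x ^ d = b}"
    using assms(2) pos by (auto simp: power_0_left split: if_splits)
  ultimately show ?thesis by simp
qed

lemma nat_power_minus_1_dvd: "(a::nat) - 1 dvd a ^ n - 1"
proof (cases "a = 0")
  case False
  have "int a - 1 dvd int a ^ n - 1"
    by (metis dvd_triv_left power_diff_1_eq)
  hence "int (a - 1) dvd int (a ^ n - 1)"
    using False by (simp add: of_nat_diff)
  thus ?thesis by (simp only: int_dvd_int_iff)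
qed (cases n; simp)

lemma nat_power_plus_1_dvd:
  assumes "odd n"
  shows "(a::nat) + 1 dvd a ^ n + 1"
proof -
  obtain j where n: "n = 2 * j + 1" using assms oddE by blast
  have "a + 1 dvd a ^ (2 * j + 1) + 1"
  proof (induction j)
    case (Suc j)
    \<comment> \<open>Adding \<open>(a + 1) * a ^ (2 * j + 1)\<close> on the left keeps the identity
      free of subtraction.\<close>
    have "a ^ (2 * Suc j + 1) + 1 + (a + 1) * a ^ (2 * j + 1) = (a + 1) * a ^ (2 * j + 2) + (a ^ (2 * j + 1) + 1)"
      by (simp add: algebra_simps)
    moreover have "a + 1 dvd (a + 1) * a ^ (2 * j + 2) + (a ^ (2 * j + 1) + 1)"
      by (rule dvd_add[OF dvd_triv_left Suc])
    ultimately show ?case by (metis dvd_add_left_iff dvd_triv_left)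
  qed simp
  thus ?thesis using n by simp
qed

lemma card_Collect_prod:
  fixes P :: "'b::finite \<Rightarrow> 'c::finite \<Rightarrow> bool"
  shows "card {(x, y). P x y} = (\<Sum>x\<in>UNIV. card {y. P x y})"
proof -
  have "{(x, y). P x y} = Sigma UNIV (\<lambda>x. {y. P x y})" by auto
  thus ?thesis by simp
qed

section \<open>Frobenius, the prime field and the trace\<close>

locale finite_field_trace =
  fixes p m :: nat and ty :: "'a::{field,finite} itself"
  assumes prime_p: "prime p" and m_pos: "m > 0"
    and card_UNIV: "CARD('a) = p ^ m" and char_p: "CHAR('a) = p"
begin

abbreviation Tr :: "'a \<Rightarrow> 'a" where "Tr \<equiv> tr p m"

text \<open>The prime field, realised inside \<open>'a\<close> as the fixed points of
  Frobenius.\<close>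

definition K :: "'a set" where "K = {x. x ^ p = x}"

lemma p_gt_1: "p > 1"
  using prime_p by (rule prime_gt_1_nat)

lemma frob_add: "((x::'a) + y) ^ (p ^ i) = x ^ (p ^ i) + y ^ (p ^ i)"
  using freshmans_dream'[of "p ^ i" i x y] prime_p char_p by simp

lemma frob_minus: "(- (x::'a)) ^ (p ^ i) = - (x ^ (p ^ i))"
proof -
  have "x ^ (p ^ i) + (- x) ^ (p ^ i) = 0"
    using frob_add[of x "- x" i] p_gt_1 by (simp add: power_0_left)
  thus ?thesis by (simp add: add_eq_0_iff)
qed

lemma frob_diff: "((x::'a) - y) ^ (p ^ i) = x ^ (p ^ i) - y ^ (p ^ i)"
  using frob_add[of x "- y" i] by (simp add: frob_minus)

text \<open>Stated for every multiple of \<open>m\<close>, so that Frobenius exponents such as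
  \<open>m * u\<close> and \<open>m * j\<close> can be cancelled later.\<close>

lemma frob_m: "(x::'a) ^ (p ^ (m * k)) = x"
proof (induction k)
  case (Suc k)
  have "x ^ (p ^ m) = x"
  proof (cases "x = 0")
    case False
    have "x ^ (p ^ m) = x ^ (p ^ m - 1) * x"
      using p_gt_1 by (simp flip: power_Suc2)
    thus ?thesis using finite_field_power_card_minus_1[OF False] by (simp add: card_UNIV)
  qed (use p_gt_1 in \<open>simp add: power_0_left\<close>)
  thus ?case using Suc by (simp add: power_add power_mult)
qed simp

lemma K_power: "l \<in> K \<Longrightarrow> l ^ (p ^ i) = l"
  by (induction i) (auto simp: K_def power_mult)

lemma K_0: "0 \<in> K" and K_1: "1 \<in> K"
  using p_gt_1 by (auto simp: K_def)

lemma K_add: "a \<in> K \<Longrightarrow> b \<in> K \<Longrightarrow> a + b \<in> K"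
  using frob_add[of a b 1] by (auto simp: K_def)

lemma K_minus: "a \<in> K \<Longrightarrow> - a \<in> K"
  using frob_minus[of a 1] by (auto simp: K_def)

lemma K_diff: "a \<in> K \<Longrightarrow> b \<in> K \<Longrightarrow> a - b \<in> K"
  using frob_diff[of a b 1] by (auto simp: K_def)

lemma K_mult: "a \<in> K \<Longrightarrow> b \<in> K \<Longrightarrow> a * b \<in> K"
  by (auto simp: K_def power_mult_distrib)

lemma K_divide: "a \<in> K \<Longrightarrow> b \<in> K \<Longrightarrow> a / b \<in> K"
  by (auto simp: K_def power_divide)

lemmas K_intros = K_0 K_1 K_add K_minus K_diff K_mult K_divide

lemma tr_add: "Tr (x + y) = Tr x + Tr y"
  by (simp add: tr_def frob_add sum.distrib)

lemma tr_diff: "Tr (x - y) = Tr x - Tr y"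
  by (simp add: tr_def frob_diff sum_subtractf)

lemma tr_0: "Tr 0 = 0"
  using tr_diff[of 0 0] by simp

lemma tr_scale: "l \<in> K \<Longrightarrow> Tr (l * x) = l * Tr x"
  by (simp add: tr_def power_mult_distrib K_power sum_distrib_left)

lemma tr_frob1: "Tr (x ^ p) = Tr x" and tr_power_p: "Tr x ^ p = Tr x"
proof -
  have "Tr x ^ p = (\<Sum>i<m. (x ^ p ^ i) ^ p ^ 1)"
    unfolding tr_def by (subst freshmans_dream_sum) (use prime_p char_p in auto)
  also have "\<dots> = (\<Sum>i<m. x ^ p ^ Suc i)"
    by (simp add: mult.commute flip: power_mult)
  also have "\<dots> = (\<Sum>i<m. x ^ p ^ i)"
  proof -
    \<comment> \<open>Cyclic shift: the new last term \<open>x ^ p ^ m\<close> equals the lost first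
      term \<open>x\<close>.\<close>
    have "(\<Sum>i<m. x ^ p ^ Suc i) + x = (\<Sum>i<Suc m. x ^ p ^ i)"
      by (subst sum.lessThan_Suc_shift) simp
    also have "\<dots> = (\<Sum>i<m. x ^ p ^ i) + x"
      using frob_m[of x 1] by simp
    finally show ?thesis by simp
  qed
  finally show "Tr x ^ p = Tr x" by (simp add: tr_def)
  have "Tr (x ^ p) = (\<Sum>i<m. x ^ p ^ Suc i)"
    by (simp add: tr_def flip: power_mult)
  also note \<open>\<dots> = (\<Sum>i<m. x ^ p ^ i)\<close>
  finally show "Tr (x ^ p) = Tr x" by (simp add: tr_def)
qed

lemma tr_frob: "Tr (x ^ (p ^ i)) = Tr x"
  by (induction i) (auto simp: power_mult tr_frob1 mult.commute[of p])

lemma tr_in_K: "Tr x \<in> K"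
  by (simp add: K_def tr_power_p)

text \<open>The nonzero fixed points are the \<open>(p ^ d - 1)\<close>-th roots of unity; the field
  contains the full number of them because \<open>p ^ d - 1\<close> divides
  \<open>p ^ m - 1\<close>.\<close>

lemma card_frob_fixed:
  assumes "d dvd m" "d > 0"
  shows "card {x::'a. x ^ (p ^ d) = x} = p ^ d"
proof -
  have gt1: "p ^ d > 1" using p_gt_1 assms by (intro one_less_power)
  have "p ^ d - 1 dvd p ^ m - 1"
    using assms nat_power_minus_1_dvd[of "p ^ d" "m div d"] by (simp flip: power_mult)
  then obtain e where "p ^ m - 1 = (p ^ d - 1) * e" by blast
  hence "card {x::'a. x ^ (p ^ d - 1) = 1} = p ^ d - 1"
    by (intro card_power_eq[where e = e]) (auto simp: card_UNIV)
  moreover have "{x::'a. x ^ (p ^ d) = x} = insert 0 {x. x ^ (p ^ d - 1) = 1}"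
  proof -
    have "x ^ (p ^ d) = x * x ^ (p ^ d - 1)" for x :: 'a
      using p_gt_1 by (simp flip: power_Suc)
    thus ?thesis by auto
  qed
  moreover have "0 \<notin> {x::'a. x ^ (p ^ d - 1) = 1}"
    using gt1 by (simp add: power_0_left)
  ultimately show ?thesis using gt1 by simp
qed

lemma card_K: "card K = p"
  using card_frob_fixed[of 1] by (simp add: K_def)

text \<open>\<open>Tr\<close> is a polynomial map of degree \<open>p ^ (m - 1)\<close> with at most
  \<open>p\<close> values on \<open>p ^ m\<close> elements, so every fibre must reach the root
  bound.\<close>

lemma card_tr_eq:
  assumes "t \<in> K"
  shows "card {x. Tr x = t} = p ^ (m - 1)"
proof -
  have "card {x \<in> UNIV. Tr x = t} = p ^ (m - 1)"
  proof (rule card_fibre_eq_of_bounds)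
    show "Tr ` UNIV \<subseteq> K" using tr_in_K by auto
    show "card (UNIV :: 'a set) = p ^ (m - 1) * p"
      using m_pos by (simp add: card_UNIV flip: power_Suc2)
    fix b :: 'a
    let ?P = "(\<Sum>i<m. monom 1 (p ^ i)) - [:b:]"
    have "coeff ?P (p ^ (m - 1)) = (\<Sum>i<m. if i = m - 1 then 1 else 0)"
      using p_gt_1 by (auto simp: coeff_sum coeff_pCons split: nat.splits intro!: sum.cong)
    hence "coeff ?P (p ^ (m - 1)) = 1" using m_pos by simp
    hence nz: "?P \<noteq> 0" by (metis coeff_0 zero_neq_one)
    have "degree ?P \<le> p ^ (m - 1)"
    proof (intro degree_diff_le degree_sum_le)
      fix i assume "i \<in> {..<m}"
      hence "p ^ i \<le> p ^ (m - 1)" using p_gt_1 by (intro power_increasing) auto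
      thus "degree (monom (1::'a) (p ^ i)) \<le> p ^ (m - 1)"
        using degree_monom_le order.trans by blast
    qed auto
    moreover have "{x \<in> UNIV. Tr x = b} = {x. poly ?P x = 0}"
      by (auto simp: poly_monom poly_sum tr_def)
    ultimately show "card {x \<in> UNIV. Tr x = b} \<le> p ^ (m - 1)"
      using card_poly_roots_bound[OF nz] by simp
  qed (use assms card_K in auto)
  thus ?thesis by simp
qed

lemma tr_surj: "t \<in> K \<Longrightarrow> \<exists>x. Tr x = t"
  using card_tr_eq[of t] p_gt_1 by (metis (mono_tags, lifting) card.empty empty_Collect_eq power_eq_0_iff not_one_less_zero)

lemma tr_nondegenerate:
  assumes "c \<noteq> 0" "t \<in> K"
  shows "\<exists>x. Tr (c * x) = t"
proof -
  obtain y where "Tr y = t" using tr_surj assms by blast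
  thus ?thesis using assms by (intro exI[of _ "y / c"]) simp
qed

lemma frob_iter: "(x::'a) ^ (p ^ a) = x \<Longrightarrow> x ^ (p ^ (a * n)) = x"
  by (induction n) (simp_all add: power_add power_mult)

lemma frob_gcd:
  assumes "(x::'a) ^ (p ^ a) = x" "a > 0"
  shows "x ^ (p ^ gcd a m) = x"
proof -
  \<comment> \<open>Bezout with natural coefficients, so that only nonnegative powers of Frobenius
    occur.\<close>
  obtain i j where ij: "a * i = m * j + gcd a m"
    using bezout_nat[of a m] assms by auto
  have "x = x ^ (p ^ (a * i))" using frob_iter[OF assms(1)] by simp
  also have "\<dots> = (x ^ (p ^ (m * j))) ^ (p ^ gcd a m)"
    by (simp add: ij power_add power_mult)
  finally show ?thesis by (simp add: frob_m)
qed

lemma card_tr_hyperplane: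
  assumes "c \<noteq> 0" "t \<in> K"
  shows "p * card {z. Tr (c * z) = t} = p ^ m"
proof -
  have "bij_betw (\<lambda>z. c * z) {z. Tr (c * z) = t} {z. Tr z = t}"
    by (rule bij_betw_byWitness[where f' = "\<lambda>z. z / c"]) (use assms in auto)
  hence "card {z. Tr (c * z) = t} = card {z. Tr z = t}" by (rule bij_betw_same_card)
  thus ?thesis using card_tr_eq[OF assms(2)] m_pos by (simp flip: power_Suc)
qed

text \<open>For \<open>a\<close> outside the prime field, \<open>Tr\<close> and
  \<open>Tr (a * _)\<close> are linearly independent functionals. A solution of
  \<open>Tr ((a - l) * x) = 1\<close> is projected along \<open>x1\<close> into the kernel of
  \<open>Tr\<close>; the choice of \<open>l\<close> makes \<open>Tr (a * _)\<close> of the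
  projection equal to \<open>Tr ((a - l) * x)\<close>.\<close>

lemma tr_separates:
  assumes "a \<notin> K"
  obtains x where "Tr x = 0" "Tr (a * x) = 1"
proof -
  obtain x1 where x1: "Tr x1 = 1" using tr_surj K_1 by blast
  define l where "l = Tr (a * x1)"
  have "l \<in> K" by (simp add: l_def tr_in_K)
  have "a - l \<noteq> 0" using assms \<open>l \<in> K\<close> by auto
  then obtain x where x: "Tr ((a - l) * x) = 1" using tr_nondegenerate K_1 by blast
  have "Tr (x - Tr x * x1) = 0" using tr_scale[OF tr_in_K] x1 by (simp add: tr_diff)
  moreover have "Tr (a * (x - Tr x * x1)) = 1"
    using x tr_scale[OF tr_in_K, of x "a * x1"] tr_scale[OF \<open>l \<in> K\<close>, of x]
    by (simp add: algebra_simps tr_diff l_def)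
  ultimately show thesis by (rule that)
qed

text \<open>All level sets of \<open>f\<close> on \<open>V\<close> are equinumerous because \<open>T\<close> moves one onto another.\<close>

lemma card_level_set:
  fixes f :: "'b \<Rightarrow> 'a"
  assumes "finite V" and f: "\<And>z. z \<in> V \<Longrightarrow> f z \<in> K" and "r \<in> K"
    and T: "\<And>l z. l \<in> K \<Longrightarrow> z \<in> V \<Longrightarrow> T l z \<in> V \<and> f (T l z) = f z + l"
    and inj: "\<And>l. l \<in> K \<Longrightarrow> inj_on (T l) V"
  shows "p * card {z \<in> V. f z = r} = card V"
proof -
  have le: "card {z \<in> V. f z = a} \<le> card {z \<in> V. f z = b}" if "a \<in> K" "b \<in> K" for a b
  proof (rule card_inj_on_le)
    show "inj_on (T (b - a)) {z \<in> V. f z = a}"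
      using inj[of "b - a"] K_diff that by (auto intro: inj_on_subset)
    show "T (b - a) ` {z \<in> V. f z = a} \<subseteq> {z \<in> V. f z = b}"
      using T K_diff that by auto
  qed (use \<open>finite V\<close> in auto)
  have "card V = (\<Sum>t\<in>K. card {z \<in> V. f z = t})"
    by (rule card_eq_sum_card_fibres) (use assms in auto)
  also have "\<dots> = (\<Sum>t\<in>K. card {z \<in> V. f z = r})"
    by (intro sum.cong refl antisym le) (use \<open>r \<in> K\<close> in auto)
  finally show ?thesis by (simp add: card_K)
qed

end

section \<open>The quadratic form \<open>Q\<close>, its polar form and its radical\<close>

locale gold_form = finite_field_trace p m ty for p m and ty :: "'a::{field,finite} itself" +
  fixes u v k w :: nat
  assumes odd_p: "odd p" and m_eq: "m = 4 * v * k" and u_eq: "u = v * w"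
    and v_pos: "v > 0" and k_pos: "k > 0" and odd_w: "odd w" and coprime_w: "coprime (2 * k) w"
begin

definition Q :: "'a \<Rightarrow> 'a" where "Q y = Tr (y ^ (p ^ u + 1))"
text \<open>The polar form of \<open>Q\<close>; see \<open>Q_add\<close>.\<close>

definition B :: "'a \<Rightarrow> 'a \<Rightarrow> 'a" where "B y z = Tr (y ^ (p ^ u) * z + y * z ^ (p ^ u))"

text \<open>The self-adjoint map with \<open>B y c = Tr (L c * y)\<close>; the exponent \<open>(m - 1) * u\<close> inverts
  the \<open>u\<close>-th power of Frobenius.\<close>

definition L :: "'a \<Rightarrow> 'a" where "L c = c ^ (p ^ u) + c ^ (p ^ ((m - 1) * u))"
text \<open>The radical of \<open>Q\<close>: the trace pairing is nondegenerate, so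
  \<open>L c = 0\<close> holds exactly when \<open>B y c = 0\<close> for all
  \<open>y\<close>.\<close>

definition R :: "'a set" where "R = {c. L c = 0}"
definition N :: "'a \<Rightarrow> nat" where "N t = card {y. Q y = t}"

lemma u_pos: "u > 0"
  using u_eq v_pos odd_w by (auto intro!: Nat.gr0I)

lemma two_neq_0: "(2::'a) \<noteq> 0"
proof
  assume "(2::'a) = 0"
  hence "of_nat 2 = (0::'a)" by simp
  hence "p dvd 2" unfolding of_nat_eq_0_iff_char_dvd char_p .
  thus False using odd_p p_gt_1 by (metis prime_nat_iff prime_p two_is_prime_nat dvd_refl less_not_refl2)
qed

lemma Q_in_K: "Q y \<in> K"
  by (simp add: Q_def tr_in_K)

text \<open>The trace is invariant under Frobenius, and raising to the power
  \<open>p ^ ((m - 1) * u)\<close> turns \<open>y ^ (p ^ u)\<close> into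
  \<open>y ^ (p ^ (m * u)) = y\<close>, which moves the twist from \<open>y\<close> to
  \<open>c\<close>.\<close>

lemma B_eq: "B y c = Tr (L c * y)"
proof -
  have "Tr (y ^ (p ^ u) * c) = Tr ((y ^ (p ^ u) * c) ^ (p ^ ((m - 1) * u)))"
    by (simp add: tr_frob)
  also have "\<dots> = Tr (y ^ (p ^ (m * u)) * c ^ (p ^ ((m - 1) * u)))"
  proof -
    have "u + (m - 1) * u = m * u" using m_pos by (cases m) auto
    thus ?thesis by (simp add: power_mult_distrib flip: power_mult power_add)
  qed
  finally show ?thesis by (simp add: B_def L_def tr_add frob_m algebra_simps)
qed

lemma B_commute: "B y z = B z y"
  by (simp add: B_def algebra_simps)

lemma B_self: "B y y = 2 * Q y"
proof -
  have "B y y = Tr (y ^ (p ^ u + 1) + y ^ (p ^ u + 1))" by (simp add: B_def mult.commute)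
  also have "\<dots> = Q y + Q y" by (simp only: tr_add Q_def)
  finally show ?thesis by simp
qed

lemma Q_add: "Q (y + z) = Q y + Q z + B y z"
  by (simp add: Q_def B_def power_add frob_add algebra_simps tr_add)

lemma L_add: "L (c + d) = L c + L d"
  by (simp add: L_def frob_add)

lemma L_diff: "L (c - d) = L c - L d"
  by (simp add: L_def frob_diff)

lemma L_scale: "l \<in> K \<Longrightarrow> L (l * c) = l * L c"
  by (simp add: L_def power_mult_distrib K_power algebra_simps)

lemma zero_in_R: "0 \<in> R"
  using L_diff[of 0 0] by (simp add: R_def)

lemma Q_R: "r \<in> R \<Longrightarrow> Q r = 0"
  using B_self[of r] two_neq_0 by (simp add: B_eq R_def tr_0)

lemma Q_add_R: "r \<in> R \<Longrightarrow> Q (y + r) = Q y"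
  using Q_R by (simp add: Q_add B_eq) (simp add: R_def tr_0)

text \<open>Applying the \<open>u\<close>-th power of Frobenius, which is injective, to
  \<open>L c = 0\<close> removes the exponent \<open>(m - 1) * u\<close> and leaves a binomial
  equation.\<close>

lemma R_iff: "c \<in> R \<longleftrightarrow> c ^ (p ^ (2 * u)) = - c"
proof -
  have "(m - 1) * u + u = m * u" using m_pos by (cases m) auto
  hence "L c ^ (p ^ u) = c ^ (p ^ (2 * u)) + c"
    by (simp add: L_def frob_add frob_m mult_2 flip: power_mult power_add)
  moreover have "L c ^ (p ^ u) = 0 \<longleftrightarrow> L c = 0" using p_gt_1 by simp
  ultimately show ?thesis by (simp add: R_def add_eq_0_iff2)
qed

text \<open>The divisibility of \<open>m\<close> by \<open>4 * v\<close> enters here. The even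
  factor \<open>p ^ (2 * v) + 1\<close> is what makes \<open>- 1\<close> a
  \<open>(p ^ (2 * v) - 1)\<close>-th power in \<open>card_R\<close>.\<close>

lemma q_minus_1_eq: "\<exists>e. p ^ m - 1 = (p ^ (2 * v) - 1) * (p ^ (2 * v) + 1) * e"
proof -
  have "(p ^ (2 * v) - 1) * (p ^ (2 * v) + 1) = p ^ (4 * v) - 1"
    by (simp add: algebra_simps flip: power_add)
  moreover have "p ^ (4 * v) - 1 dvd p ^ m - 1"
    using nat_power_minus_1_dvd[of "p ^ (4 * v)" k] by (simp add: m_eq flip: power_mult)
  ultimately show ?thesis by auto
qed

text \<open>Once one nonzero \<open>y0\<close> in \<open>R\<close> is known, \<open>r / y0\<close>
  is fixed by the \<open>2 * u\<close>-th power of Frobenius for \<open>r\<close> in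
  \<open>R\<close>, hence by the power \<open>gcd (2 * u) m = 2 * v\<close>. So \<open>R\<close> is
  \<open>y0\<close> times the subfield of order \<open>p ^ (2 * v)\<close>.\<close>

lemma card_R: "card R = p ^ (2 * v)"
proof -
  have gt1: "p ^ (2 * v) > 1" using p_gt_1 v_pos by (intro one_less_power) auto
  obtain e where e: "p ^ m - 1 = (p ^ (2 * v) - 1) * (p ^ (2 * v) + 1) * e"
    using q_minus_1_eq by blast
  have "card {x::'a. x ^ (p ^ (2 * v) - 1) = - 1} = p ^ (2 * v) - 1"
  proof (rule card_power_eq)
    show "CARD('a) - 1 = (p ^ (2 * v) - 1) * ((p ^ (2 * v) + 1) * e)"
      by (simp only: card_UNIV e mult.assoc)
    show "(- 1 :: 'a) ^ ((p ^ (2 * v) + 1) * e) = 1" using odd_p by simp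
  qed
  hence "{x::'a. x ^ (p ^ (2 * v) - 1) = - 1} \<noteq> {}" using gt1 by (intro notI) simp
  then obtain y0 :: 'a where "y0 ^ (p ^ (2 * v) - 1) = - 1" by auto
  moreover have "y0 ^ (p ^ (2 * v)) = y0 ^ (p ^ (2 * v) - 1) * y0"
    using gt1 by (simp only: power_minus_mult)
  ultimately have y0: "y0 ^ (p ^ (2 * v)) = - y0" "y0 \<noteq> 0"
    using gt1 by (auto simp: power_0_left)
  have "y0 ^ (p ^ (2 * v * n)) = (- 1) ^ n * y0" for n
  proof (induction n)
    case (Suc n)
    have "y0 ^ (p ^ (2 * v * Suc n)) = (y0 ^ (p ^ (2 * v * n))) ^ (p ^ (2 * v))"
      by (simp add: add.commute flip: power_mult power_add)
    also have "\<dots> = (- 1) ^ Suc n * y0"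
      using Suc y0(1) frob_minus[of y0 "2 * v"] by (cases "even n") auto
    finally show ?case .
  qed simp
  \<comment> \<open>Each step flips the sign; since \<open>w\<close> is odd the sign stays negative,
    so \<open>y0\<close> lies in \<open>R\<close>.\<close>
  from this[of w] have y0u: "y0 ^ (p ^ (2 * u)) = - y0"
    using odd_w by (simp add: u_eq mult.assoc)
  have gcd: "gcd (2 * u) m = 2 * v"
  proof -
    have "gcd (2 * u) m = gcd (2 * v * w) (2 * v * (2 * k))"
      by (simp add: u_eq m_eq mult_ac)
    also have "\<dots> = 2 * v * gcd w (2 * k)" by (rule gcd_mult_distrib_nat[symmetric])
    also have "gcd w (2 * k) = 1"
      using coprime_w by (simp only: coprime_iff_gcd_eq_1 gcd.commute)
    finally show ?thesis by simp
  qed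
  have "R = (\<lambda>x. x * y0) ` {x::'a. x ^ (p ^ (2 * v)) = x}"
  proof (intro set_eqI iffI)
    fix r assume "r \<in> R"
    hence "(r / y0) ^ (p ^ (2 * u)) = r / y0"
      using y0u by (simp add: R_iff power_divide)
    hence "(r / y0) ^ (p ^ (2 * v)) = r / y0"
      using frob_gcd[of "r / y0" "2 * u"] u_pos gcd by simp
    thus "r \<in> (\<lambda>x. x * y0) ` {x. x ^ (p ^ (2 * v)) = x}"
      using y0 by (intro image_eqI[of _ _ "r / y0"]) auto
  next
    fix r assume "r \<in> (\<lambda>x. x * y0) ` {x. x ^ (p ^ (2 * v)) = x}"
    then obtain x where "r = x * y0" "x ^ (p ^ (2 * v)) = x" by auto
    moreover from this have "x ^ (p ^ (2 * u)) = x"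
      using frob_iter[of x "2 * v" w] by (simp add: u_eq mult.assoc)
    ultimately show "r \<in> R" using y0u by (simp add: R_iff power_mult_distrib)
  qed
  moreover have "inj_on (\<lambda>x. x * y0) {x. x ^ (p ^ (2 * v)) = x}"
    using y0 by (auto intro: inj_onI)
  moreover have "2 * v dvd m" using dvd_triv_left[of "2 * v" "2 * k"] by (simp add: m_eq mult.assoc)
  ultimately show ?thesis using card_frob_fixed[of "2 * v"] v_pos by (simp add: card_image)
qed

section \<open>Sizes of the level sets of \<open>Q\<close>\<close>

lemma norm_power_transfer:
  assumes "x ^ (p ^ v + 1) = (t::'a)" "t \<in> K" "t \<noteq> 0"
  shows "x ^ (p ^ u + 1) = t"
proof -
  have nz: "x \<noteq> 0" using assms by auto
  have 1: "x ^ (p ^ v) = t / x" using assms nz by (simp add: field_simps)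
  \<comment> \<open>Frobenius fixes \<open>t\<close>, so replacing \<open>x\<close> by
    \<open>t / x\<close> twice gives back \<open>x\<close>; thus \<open>x\<close> lies in the
    subfield of order \<open>p ^ (2 * v)\<close>, where \<open>p ^ v + 1\<close> is a norm
    exponent.\<close>
  have "x ^ (p ^ (2 * v)) = (x ^ (p ^ v)) ^ (p ^ v)"
    by (simp add: mult_2 flip: power_mult power_add)
  also have "\<dots> = x" using nz assms by (simp add: 1 power_divide K_power)
  finally have "x ^ (p ^ (2 * v)) = x" .
  hence 2: "x ^ (p ^ (2 * v * n)) = x" for n by (rule frob_iter)
  \<comment> \<open>Now \<open>u = v + 2 * v * j\<close>, so raising \<open>x\<close> to
    \<open>p ^ u\<close> and to \<open>p ^ v\<close> is the same.\<close>
  obtain j where "w = 2 * j + 1" using odd_w oddE by blast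
  hence "x ^ (p ^ u) = (x ^ (p ^ (2 * v * j))) ^ (p ^ v)"
    by (simp add: u_eq algebra_simps flip: power_mult power_add)
  hence "x ^ (p ^ u) = x ^ (p ^ v)" using 2 by simp
  thus ?thesis using assms by simp
qed

lemma q_minus_1_eq': "\<exists>e. p ^ m - 1 = (p ^ v + 1) * ((p - 1) * e)"
proof -
  obtain e where "p ^ m - 1 = (p ^ (2 * v) - 1) * (p ^ (2 * v) + 1) * e"
    using q_minus_1_eq by blast
  moreover have "p ^ (2 * v) - 1 = (p ^ v + 1) * (p ^ v - 1)"
    by (simp add: algebra_simps flip: power_add mult_2_right)
  moreover obtain f where "p ^ v - 1 = (p - 1) * f"
    using nat_power_minus_1_dvd by blast
  ultimately show ?thesis by (intro exI[of _ "f * (p ^ (2 * v) + 1) * e"]) (simp only: mult_ac)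
qed

text \<open>Multiplication by a \<open>(p ^ u + 1)\<close>-th root \<open>x\<close> of
  \<open>t\<close> scales \<open>Q\<close> by \<open>t\<close>. The root is found for the exponent
  \<open>p ^ v + 1\<close>, using \<open>t ^ (p - 1) = 1\<close>, and carried over by
  \<open>norm_power_transfer\<close>.\<close>

lemma N_eq_N_1:
  assumes "t \<in> K" "t \<noteq> 0"
  shows "N t = N 1"
proof -
  obtain e where e: "p ^ m - 1 = (p ^ v + 1) * ((p - 1) * e)" using q_minus_1_eq' by blast
  have "t * t ^ (p - 1) = t * 1" using assms p_gt_1 by (simp add: K_def flip: power_Suc)
  hence "t ^ (p - 1) = 1" using assms by simp
  hence "card {x::'a. x ^ (p ^ v + 1) = t} = p ^ v + 1"
    using e by (intro card_power_eq[where e = "(p - 1) * e"]) (auto simp: card_UNIV power_mult)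
  hence "{x::'a. x ^ (p ^ v + 1) = t} \<noteq> {}" by (intro notI) simp
  then obtain x where "x ^ (p ^ v + 1) = t" by blast
  hence x: "x ^ (p ^ u + 1) = t" using norm_power_transfer assms by blast
  hence "x \<noteq> 0" using assms by auto
  have Q: "Q (x * y) = t * Q y" for y
    by (simp only: Q_def power_mult_distrib x tr_scale[OF assms(1)])
  have "bij_betw (\<lambda>y. x * y) {y. Q y = 1} {y. Q y = t}"
  proof (rule bij_betw_byWitness[where f' = "\<lambda>y. y / x"])
    show "(\<lambda>y. y / x) ` {y. Q y = t} \<subseteq> {y. Q y = 1}"
    proof clarify
      fix y assume "t = Q y"
      thus "Q (y / x) = 1" using Q[of "y / x"] \<open>x \<noteq> 0\<close> \<open>t \<noteq> 0\<close> by simp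
    qed
  qed (use Q \<open>x \<noteq> 0\<close> in auto)
  thus ?thesis by (simp add: N_def bij_betw_same_card)
qed

text \<open>The \<open>(p ^ v + 1)\<close>-th roots of unity act freely on each nonzero level set of \<open>Q\<close>.\<close>

lemma dvd_N:
  assumes "t \<noteq> 0"
  shows "p ^ v + 1 dvd N t"
proof -
  obtain e where e: "p ^ m - 1 = (p ^ v + 1) * ((p - 1) * e)" using q_minus_1_eq' by blast
  let ?S = "{y. Q y = t}" and ?f = "\<lambda>y::'a. y ^ (p ^ v + 1)"
  have "card {y \<in> ?S. ?f y = b} = p ^ v + 1" if b: "b \<in> ?f ` ?S" for b
  proof -
    obtain z where z: "Q z = t" "b = ?f z" using b by auto
    have "z \<noteq> 0" using z assms Q_R zero_in_R by auto
    have "Q y = t" if "?f y = b" for y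
    proof -
      have "(y / z) ^ (p ^ u + 1) = 1"
      proof (rule norm_power_transfer)
        show "(y / z) ^ (p ^ v + 1) = 1"
          using that \<open>z \<noteq> 0\<close> unfolding power_divide z(2) by simp
      qed (use K_1 in auto)
      hence "y ^ (p ^ u + 1) = z ^ (p ^ u + 1)"
        unfolding power_divide using \<open>z \<noteq> 0\<close> by simp
      thus ?thesis using z by (simp add: Q_def)
    qed
    hence "{y \<in> ?S. ?f y = b} = {y. ?f y = b}" by auto
    moreover have "card \<dots> = p ^ v + 1"
    proof (rule card_power_eq)
      show "CARD('a) - 1 = (p ^ v + 1) * ((p - 1) * e)" by (simp only: card_UNIV e)
      show "b ^ ((p - 1) * e) = 1"
        using finite_field_power_card_minus_1[OF \<open>z \<noteq> 0\<close>]
        unfolding card_UNIV e z(2) by (simp only: power_mult)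
    qed
    ultimately show ?thesis by simp
  qed
  hence "N t = (\<Sum>b\<in>?f ` ?S. p ^ v + 1)"
    unfolding N_def by (subst card_eq_sum_card_fibres[of _ "?f ` ?S" ?f]) auto
  thus ?thesis by (simp only: sum_constant dvd_triv_right)
qed

lemma sum_N: "N 0 + (p - 1) * N 1 = p ^ m"
proof -
  have "p ^ m = card (UNIV :: 'a set)" by (simp add: card_UNIV)
  also have "\<dots> = (\<Sum>t\<in>K. N t)"
    unfolding N_def by (subst card_eq_sum_card_fibres[of _ K Q]) (auto simp: Q_in_K)
  also have "\<dots> = N 0 + (\<Sum>t\<in>K-{0}. N t)" using K_0 by (subst sum.remove[of K 0]) auto
  also have "(\<Sum>t\<in>K-{0}. N t) = (\<Sum>t\<in>K-{0}. N 1)" by (intro sum.cong) (auto simp: N_eq_N_1)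
  finally show ?thesis using card_K K_0 by (simp add: card_Diff_singleton)
qed

text \<open>The second moment of the level set sizes, obtained by sorting the pairs by their common
  value. \<open>sum_N\<close> is the first moment.\<close>

lemma sum_N_sq: "N 0 ^ 2 + (p - 1) * N 1 ^ 2 = card {(y, z). Q y = Q z}"
proof -
  have "card {(y, z). Q y = Q z} = (\<Sum>t\<in>K. card {x \<in> {(y, z). Q y = Q z}. Q (fst x) = t})"
    by (rule card_eq_sum_card_fibres) (auto simp: Q_in_K)
  also have "\<dots> = (\<Sum>t\<in>K. N t ^ 2)"
  proof (rule sum.cong)
    fix t
    have "{x \<in> {(y, z). Q y = Q z}. Q (fst x) = t} = {y. Q y = t} \<times> {y. Q y = t}" by auto
    thus "card {x \<in> {(y, z). Q y = Q z}. Q (fst x) = t} = N t ^ 2"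
      by (simp add: N_def power2_eq_square card_cartesian_product)
  qed simp
  also have "\<dots> = N 0 ^ 2 + (\<Sum>t\<in>K-{0}. N t ^ 2)" using K_0 by (subst sum.remove[of K 0]) auto
  also have "(\<Sum>t\<in>K-{0}. N t ^ 2) = (\<Sum>t\<in>K-{0}. N 1 ^ 2)" by (intro sum.cong) (auto simp: N_eq_N_1)
  finally show ?thesis using card_K K_0 by (simp add: card_Diff_singleton)
qed

text \<open>Substituting \<open>y = x + z\<close> turns \<open>Q y = Q z\<close> into
  \<open>Q x + B x z = 0\<close>, which is affine in \<open>z\<close>: a hyperplane for
  \<open>x\<close> outside \<open>R\<close>, and no condition for \<open>x\<close> in
  \<open>R\<close>, where \<open>Q x = 0\<close>.\<close>

lemma card_equal_Q:
  "p * card {(y, z). Q y = Q z} = p * p ^ (2 * v) * p ^ m + (p ^ m - p ^ (2 * v)) * p ^ m"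
proof -
  have "card {(y, z). Q y = Q z} = card {(x, z). Q x + B x z = 0}"
  proof (rule bij_betw_same_card, rule bij_betw_byWitness[where f' = "\<lambda>(x, z). (x + z, z)"])
    show "(\<lambda>(y, z). (y - z, z)) ` {(y, z). Q y = Q z} \<subseteq> {(x, z). Q x + B x z = 0}"
    proof clarify
      fix y z assume "Q y = Q z"
      thus "Q (y - z) + B (y - z) z = 0" using Q_add[of "y - z" z] by simp
    qed
  qed (auto simp: Q_add)
  also have "\<dots> = (\<Sum>x\<in>UNIV. card {z. Q x + B x z = 0})" by (rule card_Collect_prod)
  finally have "p * card {(y, z). Q y = Q z} = (\<Sum>x\<in>UNIV. p * card {z. Q x + B x z = 0})"
    by (simp add: sum_distrib_left)
  also have "\<dots> = (\<Sum>x\<in>UNIV. if x \<in> R then p * p ^ m else p ^ m)"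
  proof (rule sum.cong)
    fix x :: 'a
    have *: "{z. Q x + B x z = 0} = {z. Tr (L x * z) = - Q x}"
      using B_commute[of x] by (auto simp: B_eq add_eq_0_iff)
    show "p * card {z. Q x + B x z = 0} = (if x \<in> R then p * p ^ m else p ^ m)"
    proof (cases "x \<in> R")
      case True
      hence "{z. Tr (L x * z) = - Q x} = UNIV" by (simp add: Q_R) (simp add: R_def tr_0)
      thus ?thesis using True by (simp add: * card_UNIV)
    next
      case False
      thus ?thesis unfolding * using card_tr_hyperplane[of "L x" "- Q x"] Q_in_K K_minus
        by (simp add: R_def)
    qed
  qed simp
  also have "\<dots> = card R * (p * p ^ m) + card (- R) * p ^ m"
    by (subst sum.If_cases) (auto simp: mult.commute)
  also have "card (- R) = p ^ m - p ^ (2 * v)"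
    by (simp add: Compl_eq_Diff_UNIV card_Diff_subset card_UNIV card_R)
  finally show ?thesis by (simp add: card_R mult_ac)
qed

text \<open>The two moments give \<open>d ^ 2 = D ^ 2\<close> for the deviation \<open>d\<close>.
  Modulo \<open>p ^ v + 1\<close>, the values of \<open>N 1\<close>, \<open>q\<close> and
  \<open>D\<close> are \<open>0\<close>, \<open>1\<close> and \<open>- 1\<close>, the last because
  \<open>D\<close> is an odd power of \<open>p ^ v\<close>; this excludes
  \<open>d = D\<close>.\<close>

lemma level_card_eqs:
  "p * N 1 = p ^ m + p ^ (2 * v * k + v)"
  "p * N 0 + (p - 1) * p ^ (2 * v * k + v) = p ^ m"
proof -
  define P q r D where "P = int p" and "q = int (p ^ m)" and "r = int (p ^ (2 * v))"
    and "D = int (p ^ (2 * v * k + v))"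
  \<comment> \<open>The deviation of \<open>P * N 1\<close> from the uniform value \<open>q\<close>;
    by the first moment \<open>P * N 0\<close> deviates by \<open>(P - 1) * d\<close> the other
    way.\<close>
  define d where "d = q - P * int (N 1)"
  have P: "P > 1" using p_gt_1 by (simp add: P_def)
  have P1: "int (p - Suc 0) = P - 1" using p_gt_1 by (simp add: P_def of_nat_diff)
  have s1: "int (N 0) + (P - 1) * int (N 1) = q"
    using arg_cong[OF sum_N, of int] by (simp add: P1 q_def)
  have le: "p ^ (2 * v) \<le> p ^ m"
    using p_gt_1 k_pos by (intro power_increasing) (auto simp: m_eq)
  have s2: "P * (int (N 0) ^ 2 + (P - 1) * int (N 1) ^ 2) = P * r * q + (q - r) * q"
    using arg_cong[OF card_equal_Q, of int] le
    by (simp add: P1 q_def r_def P_def of_nat_diff flip: sum_N_sq)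
  have N0: "P * int (N 0) = q + (P - 1) * d"
    using s1 unfolding d_def by (simp add: algebra_simps flip: s1)
  have "P * (P * r * q + (q - r) * q) = (P * int (N 0)) ^ 2 + (P - 1) * (P * int (N 1)) ^ 2"
    unfolding s2[symmetric] by (simp add: algebra_simps power2_eq_square)
  also have "\<dots> = (q + (P - 1) * d) ^ 2 + (P - 1) * (q - d) ^ 2"
    unfolding N0 by (simp add: d_def)
  finally have "P * (P - 1) * d ^ 2 = P * (P - 1) * (r * q)"
    by (simp add: algebra_simps power2_eq_square)
  hence "d ^ 2 = r * q" using P by simp
  also have "\<dots> = D ^ 2"
    by (simp add: r_def q_def D_def m_eq algebra_simps flip: power_mult power_add)
  finally have dD: "d = D \<or> d = - D" by (simp add: power2_eq_iff)
  have "d \<noteq> D"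
  proof
    assume "d = D"
    hence eq: "P * int (N 1) = q - D" by (simp add: d_def)
    let ?g = "int (p ^ v + 1)"
    have "?g dvd P * int (N 1)"
      using dvd_N[of 1] by (intro dvd_mult) (simp only: int_dvd_int_iff zero_neq_one[symmetric] not_False_eq_True)
    moreover have "?g dvd D + 1"
    proof -
      have "p ^ v + 1 dvd (p ^ v) ^ (2 * k + 1) + 1" by (intro nat_power_plus_1_dvd) simp
      also have "(p ^ v) ^ (2 * k + 1) = p ^ (2 * v * k + v)"
        by (simp add: algebra_simps flip: power_mult power_add)
      finally have "?g dvd int (p ^ (2 * v * k + v) + 1)" by (simp only: int_dvd_int_iff)
      thus ?thesis by (simp add: D_def add.commute)
    qed
    moreover have "?g dvd q - 1"
    proof -
      obtain e where "p ^ m - 1 = (p ^ v + 1) * ((p - 1) * e)" using q_minus_1_eq' by blast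
      hence "p ^ v + 1 dvd p ^ m - 1" by (simp only: dvd_triv_left)
      hence "?g dvd int (p ^ m - 1)" by (simp only: int_dvd_int_iff)
      thus ?thesis using p_gt_1 by (simp add: q_def of_nat_diff)
    qed
    \<comment> \<open>With \<open>P * int (N 1) = q - D\<close> everything cancels except
      \<open>- 2\<close>, while \<open>p ^ v + 1\<close> exceeds \<open>2\<close>.\<close>
    ultimately have "?g dvd (q - 1) - (D + 1) - P * int (N 1)" by (meson dvd_diff)
    hence "?g dvd - 2" by (simp add: eq)
    hence "?g \<le> int 2" using zdvd_imp_le[of ?g 2] by simp
    hence "p ^ v + 1 \<le> 2" by (simp only: of_nat_le_iff)
    moreover have "p ^ v > 1" using p_gt_1 v_pos by (rule one_less_power)
    ultimately show False by simp
  qed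
  with dD have d: "d = - D" by simp
  have "int (p * N 1) = int (p ^ m + p ^ (2 * v * k + v))"
    using d by (simp add: d_def P_def q_def D_def)
  thus "p * N 1 = p ^ m + p ^ (2 * v * k + v)" by (simp only: of_nat_eq_iff)
  have "int (p * N 0 + (p - 1) * p ^ (2 * v * k + v)) = P * int (N 0) + (P - 1) * D"
    by (simp add: P1 P_def D_def)
  also have "\<dots> = int (p ^ m)" by (simp add: N0 d q_def)
  finally show "p * N 0 + (p - 1) * p ^ (2 * v * k + v) = p ^ m" by (simp only: of_nat_eq_iff)
qed

section \<open>Solutions of \<open>Q y = Tr (b * y)\<close>\<close>

definition Z :: "'a \<Rightarrow> nat" where "Z b = card {y. Q y = Tr (b * y)}"

text \<open>Completing the square: in the shifted equation the terms \<open>B y c\<close> cancel,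
  and \<open>B c c = 2 * Q c\<close> leaves \<open>Q y = Q c\<close>.\<close>

lemma Z_L: "Z (L c) = N (Q c)"
proof -
  have "bij_betw (\<lambda>y. y + c) {y. Q y = Q c} {y. Q y = Tr (L c * y)}"
  proof (rule bij_betw_byWitness[where f' = "\<lambda>y. y - c"])
    have *: "Q (y + c) = Tr (L c * (y + c)) \<longleftrightarrow> Q y = Q c" for y
      using B_self[of c] B_eq[of c c] B_eq[of y c]
      by (auto simp: Q_add distrib_left tr_add)
    show "(\<lambda>y. y + c) ` {y. Q y = Q c} \<subseteq> {y. Q y = Tr (L c * y)}"
      using * by auto
    show "(\<lambda>y. y - c) ` {y. Q y = Tr (L c * y)} \<subseteq> {y. Q y = Q c}"
      using *[of "_ - c"] by auto
  qed auto
  thus ?thesis by (simp add: Z_def N_def bij_betw_same_card)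
qed

text \<open>\<open>S\<close> is a union of cosets of \<open>R\<close>, and these are the fibres of
  the additive map \<open>L\<close>. Applied both to the whole field and to the zero level set of
  \<open>Q\<close>.\<close>

lemma card_L_image:
  assumes "\<And>c r. c \<in> S \<Longrightarrow> r \<in> R \<Longrightarrow> c + r \<in> S"
  shows "card S = p ^ (2 * v) * card (L ` S)"
proof -
  have "card S = (\<Sum>b\<in>L ` S. card {c \<in> S. L c = b})"
    by (rule card_eq_sum_card_fibres) auto
  also have "\<dots> = (\<Sum>b\<in>L ` S. p ^ (2 * v))"
  proof (rule sum.cong)
    fix b assume "b \<in> L ` S"
    then obtain c where c: "c \<in> S" "b = L c" by auto
    have "bij_betw (\<lambda>r. c + r) R {c \<in> S. L c = b}"
      by (rule bij_betw_byWitness[where f' = "\<lambda>x. x - c"])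
        (use c assms in \<open>auto simp: R_def L_add L_diff\<close>)
    thus "card {c \<in> S. L c = b} = p ^ (2 * v)" using bij_betw_same_card card_R by metis
  qed simp
  finally show ?thesis by (simp add: mult.commute)
qed

text \<open>Double counting of the pairs \<open>(b, r)\<close> with \<open>r\<close> in
  \<open>R\<close> and \<open>Tr (b * r) = 0\<close>. For fixed \<open>b\<close> they fill all of
  \<open>R\<close> or one \<open>p\<close>-th of it; for fixed \<open>r\<close> they fill the field
  if \<open>r = 0\<close> and a hyperplane otherwise.\<close>

lemma card_R_orthogonal:
  "p ^ (2 * v) * card {b. \<forall>r\<in>R. Tr (b * r) = 0} = p ^ m" (is "_ * card ?O = _")
proof -
  let ?A = "{(b, r). r \<in> R \<and> Tr (b * r) = 0}" and ?q = "p ^ m" and ?r = "p ^ (2 * v)"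
  have "card ?A = (\<Sum>b\<in>UNIV. card {r. r \<in> R \<and> Tr (b * r) = 0})" by (rule card_Collect_prod)
  hence "p * card ?A = (\<Sum>b\<in>UNIV. p * card {r. r \<in> R \<and> Tr (b * r) = 0})"
    by (simp add: sum_distrib_left)
  also have "\<dots> = (\<Sum>b\<in>UNIV. if b \<in> ?O then p * ?r else ?r)"
  proof (rule sum.cong)
    fix b :: 'a
    show "p * card {r. r \<in> R \<and> Tr (b * r) = 0} = (if b \<in> ?O then p * ?r else ?r)"
    proof (cases "b \<in> ?O")
      case True
      hence "{r. r \<in> R \<and> Tr (b * r) = 0} = R" by auto
      thus ?thesis using True card_R by simp
    next
      case False
      then obtain r where r: "r \<in> R" "Tr (b * r) \<noteq> 0" by auto
      have "p * card {x \<in> R. Tr (b * x) = 0} = card R"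
      \<comment> \<open>Translation by a suitable prime field multiple of \<open>r\<close> shifts
        the trace by exactly \<open>l\<close> and stays in \<open>R\<close>, as \<open>L\<close> is
        linear over \<open>K\<close>.\<close>
      proof (rule card_level_set[where T = "\<lambda>l x. x + l / Tr (b * r) * r"])
        fix l x assume "l \<in> K" "x \<in> R"
        have l: "l / Tr (b * r) \<in> K" using \<open>l \<in> K\<close> tr_in_K K_divide by blast
        show "x + l / Tr (b * r) * r \<in> R \<and> Tr (b * (x + l / Tr (b * r) * r)) = Tr (b * x) + l"
          using r \<open>x \<in> R\<close> L_scale[OF l, of r] tr_scale[OF l, of "b * r"]
          by (simp add: R_def L_add distrib_left tr_add mult.left_commute)
      qed (use tr_in_K K_0 in \<open>auto intro: inj_onI\<close>)
      thus ?thesis unfolding if_not_P[OF False] card_R .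
    qed
  qed simp
  also have "\<dots> = card ?O * (p * ?r) + card (- ?O) * ?r"
    by (subst sum.If_cases) (auto simp: mult.commute)
  also have "card (- ?O) = ?q - card ?O"
    by (simp add: Compl_eq_Diff_UNIV card_Diff_subset card_UNIV)
  finally have 1: "p * card ?A = card ?O * (p * ?r) + (?q - card ?O) * ?r" .
  have "card ?A = card {(r, b). r \<in> R \<and> Tr (b * r) = 0}"
    by (rule bij_betw_same_card, rule bij_betw_byWitness[where f = "\<lambda>(x, y). (y, x)" and f' = "\<lambda>(x, y). (y, x)"]) auto
  also have "\<dots> = (\<Sum>r\<in>UNIV. card {b. r \<in> R \<and> Tr (b * r) = 0})" by (rule card_Collect_prod)
  also have "\<dots> = (\<Sum>r\<in>R. card {b. Tr (b * r) = 0})"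
    by (rule sum.mono_neutral_cong_right) auto
  finally have "p * card ?A = (\<Sum>r\<in>R. p * card {b. Tr (b * r) = 0})"
    by (simp add: sum_distrib_left)
  also have "\<dots> = p * card {b. Tr (b * 0) = 0} + (\<Sum>r\<in>R-{0}. p * card {b. Tr (b * r) = 0})"
    using zero_in_R by (subst sum.remove[of R 0]) auto
  also have "(\<Sum>r\<in>R-{0}. p * card {b. Tr (b * r) = 0}) = (\<Sum>r\<in>R-{0}. ?q)"
    using card_tr_hyperplane[OF _ K_0] by (intro sum.cong) (auto simp: mult.commute[of _ "_::'a"])
  also have "\<dots> = (?r - 1) * ?q" using zero_in_R card_R by (simp add: card_Diff_singleton)
  also have "p * card {b::'a. Tr (b * 0) = 0} = p * ?q" by (simp add: tr_0 card_UNIV)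
  finally have 2: "p * card ?A = p * ?q + (?r - 1) * ?q" .
  have le: "card ?O \<le> ?q" using card_mono[of UNIV ?O] by (simp add: card_UNIV)
  have r1: "?r \<ge> 1" using p_gt_1 by simp
  have "int (card ?O * (p * ?r) + (?q - card ?O) * ?r) = int (p * ?q + (?r - 1) * ?q)"
    using 1 2 by simp
  hence "int (card ?O) * (int p * int ?r) + (int ?q - int (card ?O)) * int ?r
      = int p * int ?q + (int ?r - int 1) * int ?q"
    by (simp only: of_nat_add of_nat_mult of_nat_diff[OF le] of_nat_diff[OF r1])
  hence "(int p - 1) * int (?r * card ?O) = (int p - 1) * int ?q"
    by (simp add: algebra_simps)
  thus ?thesis using p_gt_1 by (simp only: mult_cancel_left of_nat_eq_iff) auto
qed

text \<open>\<open>L\<close> is self-adjoint for the trace pairing, so its image is orthogonal to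
  its kernel \<open>R\<close>; equal cardinalities make the inclusion an equality.\<close>

lemma range_L: "range L = {b. \<forall>r\<in>R. Tr (b * r) = 0}" (is "_ = ?O")
proof (rule card_subset_eq)
  show "range L \<subseteq> ?O"
  proof clarify
    fix c r assume "r \<in> R"
    have "Tr (L c * r) = Tr (L r * c)" using B_commute[of r c] by (simp add: B_eq)
    thus "Tr (L c * r) = 0" using \<open>r \<in> R\<close> by (simp add: R_def tr_0)
  qed
  show "card (range L) = card ?O"
    using card_L_image[of UNIV] card_R_orthogonal p_gt_1 by (simp add: card_UNIV)
qed simp

text \<open>Some \<open>r\<close> in the radical has \<open>Tr (b * r) \<noteq> 0\<close>.
  Translation along \<open>r\<close> leaves \<open>Q\<close> unchanged and moves
  \<open>Tr (b * y)\<close> through all of \<open>K\<close>.\<close>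

lemma Z_not_L:
  assumes "b \<notin> range L"
  shows "p * Z b = p ^ m"
proof -
  obtain r where r: "r \<in> R" "Tr (b * r) \<noteq> 0" using assms unfolding range_L by auto
  have "p * card {y \<in> UNIV. Tr (b * y) - Q y = 0} = card (UNIV :: 'a set)"
  proof (rule card_level_set[where T = "\<lambda>l x. x + l / Tr (b * r) * r"])
    fix l x assume "l \<in> K"
    have l: "l / Tr (b * r) \<in> K" using \<open>l \<in> K\<close> tr_in_K K_divide by blast
    have "l / Tr (b * r) * r \<in> R" using r L_scale[OF l, of r] by (simp add: R_def)
    thus "x + l / Tr (b * r) * r \<in> UNIV \<and>
      Tr (b * (x + l / Tr (b * r) * r)) - Q (x + l / Tr (b * r) * r) = Tr (b * x) - Q x + l"
      using r tr_scale[OF l, of "b * r"] by (simp add: Q_add_R distrib_left tr_add mult.left_commute)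
  qed (use tr_in_K Q_in_K K_0 K_diff in \<open>auto intro: inj_onI\<close>)
  moreover have "{y \<in> UNIV. Tr (b * y) - Q y = 0} = {y. Q y = Tr (b * y)}" by auto
  ultimately show ?thesis by (simp add: Z_def card_UNIV)
qed

section \<open>Weights computed from the numbers of zero coordinates\<close>

definition E :: "('a \<times> 'a) set" where "E = {(x, y). Tr x + Q y = 0}"
definition M :: "'a \<Rightarrow> 'a \<Rightarrow> nat" where "M a b = card {(x, y) \<in> E. Tr (a * x + b * y) = 0}"
definition wt :: "'a \<Rightarrow> 'a \<Rightarrow> nat" where "wt a b = hwt p m u (cw p m u a b)"

text \<open>Adjoining the origin makes \<open>E\<close> a full level set, so counts over it carry no
  exceptional point.\<close>

lemma E_eq: "E = insert (0, 0) (D1 p m u)" and zero_notin_D1: "(0, 0) \<notin> (D1 p m u :: ('a \<times> 'a) set)"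
proof -
  have "tr p m (x + y ^ (p ^ u + 1)) = Tr x + Q y" for x y :: 'a
    by (simp only: tr_add Q_def)
  thus "E = insert (0, 0) (D1 p m u)"
    using Q_R[OF zero_in_R] tr_0 unfolding E_def D1_def by auto
qed (simp add: D1_def)

text \<open>For fixed \<open>y\<close>, translating \<open>x\<close> by \<open>l * x0\<close> shifts
  \<open>Tr x + Q y\<close> by \<open>l\<close>, so each \<open>y\<close> contributes
  equally.\<close>

lemma card_graph:
  "p * card {(x, y). y \<in> S \<and> Tr x + Q y = 0} = p ^ m * card S"
proof -
  obtain x0 where x0: "Tr x0 = 1" using tr_surj K_1 by blast
  have "p * card {z \<in> UNIV \<times> S. Tr (fst z) + Q (snd z) = 0} = card ((UNIV :: 'a set) \<times> S)"
    by (rule card_level_set[where T = "\<lambda>l z. (fst z + l * x0, snd z)"])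
      (use x0 tr_in_K Q_in_K in \<open>auto simp: tr_add tr_scale K_intros intro!: inj_onI\<close>)
  moreover have "{z \<in> UNIV \<times> S. Tr (fst z) + Q (snd z) = 0} = {(x, y). y \<in> S \<and> Tr x + Q y = 0}"
    by auto
  ultimately show ?thesis by (simp add: card_cartesian_product card_UNIV)
qed

lemma card_E: "p * card E = p ^ (2 * m)"
  using card_graph[of UNIV] by (simp add: E_def card_UNIV mult_2 power_add)

text \<open>The origin is counted once in \<open>M a b\<close> and once in \<open>card E\<close>, so
  it does not affect the weight.\<close>

lemma wt_plus_M: "wt a b + M a b = card E"
proof -
  have "{z \<in> D1 p m u. cw p m u a b z \<noteq> 0} = E - {(x, y) \<in> E. Tr (a * x + b * y) = 0}"
    by (auto simp: E_eq cw_def tr_0)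
  moreover have "{(x, y) \<in> E. Tr (a * x + b * y) = 0} \<subseteq> E" by auto
  moreover from this have "card {(x, y) \<in> E. Tr (a * x + b * y) = 0} \<le> card E"
    by (intro card_mono) auto
  ultimately show ?thesis by (simp add: wt_def hwt_def M_def card_Diff_subset)
qed

text \<open>\<open>tr_separates\<close> supplies a direction \<open>x0\<close> that stays inside
  \<open>E\<close> and moves \<open>Tr (a * x + b * y)\<close>.\<close>

lemma M_not_K:
  assumes "a \<notin> K"
  shows "p * M a b = card E"
proof -
  obtain x0 where x0: "Tr x0 = 0" "Tr (a * x0) = 1" using tr_separates assms by blast
  have "p * card {z \<in> E. Tr (a * fst z + b * snd z) = 0} = card E"
  proof (rule card_level_set[where T = "\<lambda>l z. (fst z + l * x0, snd z)"])
    fix l z assume l: "l \<in> K" and "z \<in> E"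
    thus "(fst z + l * x0, snd z) \<in> E \<and> Tr (a * fst (fst z + l * x0, snd z) + b * snd (fst z + l * x0, snd z))
        = Tr (a * fst z + b * snd z) + l"
      using x0 tr_scale[OF l, of "a * x0"] tr_scale[OF l, of x0]
      by (auto simp: E_def tr_add distrib_left mult.left_commute)
  qed (use tr_in_K K_0 in \<open>auto intro!: inj_onI\<close>)
  moreover have "{z \<in> E. Tr (a * fst z + b * snd z) = 0} = {(x, y) \<in> E. Tr (a * x + b * y) = 0}"
    by auto
  ultimately show ?thesis by (simp add: M_def)
qed

lemma M_0:
  assumes "b \<noteq> 0"
  shows "p * M 0 b = card E"
proof -
  have "M 0 b = card {(x, y). y \<in> {y. Tr (b * y) = 0} \<and> Tr x + Q y = 0}"
    unfolding M_def by (rule arg_cong[of _ _ card]) (auto simp: E_def)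
  hence "p * (p * M 0 b) = p ^ m * (p * card {y. Tr (b * y) = 0})"
    by (simp only: card_graph mult.left_commute)
  also have "\<dots> = p * card E"
    using card_tr_hyperplane[OF assms K_0] by (simp add: card_E mult_2 power_add)
  finally show ?thesis using p_gt_1 by simp
qed

text \<open>A factor \<open>a\<close> from the prime field can be pulled out of the trace, and
  \<open>Tr x = - Q y\<close> on \<open>E\<close> then eliminates \<open>x\<close> from the second
  condition.\<close>

lemma M_K:
  assumes "a \<in> K" "a \<noteq> 0"
  shows "p * M a b = p ^ m * Z (b / a)"
proof -
  have "Tr x + Q y = 0 \<and> Tr (a * x + b * y) = 0 \<longleftrightarrow> Q y = Tr (b / a * y) \<and> Tr x + Q y = 0" for x y
  proof -
    have "Tr (a * x + b * y) = Tr (a * (x + b / a * y))" using assms by (simp add: algebra_simps)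
    also have "\<dots> = a * (Tr x + Tr (b / a * y))" using assms by (simp only: tr_scale tr_add)
    finally show ?thesis using assms by (auto simp: add_eq_0_iff)
  qed
  hence "{(x, y) \<in> E. Tr (a * x + b * y) = 0}
      = {(x, y). y \<in> {y. Q y = Tr (b / a * y)} \<and> Tr x + Q y = 0}"
    by (auto simp: E_def)
  thus ?thesis unfolding M_def Z_def by (simp only: card_graph)
qed

definition W1 :: real where "W1 = real (p - 1) * real p ^ (2 * m - 2)"
definition W2 :: real where "W2 = real (p - 1) * real p ^ (2 * m - 2) * (1 + 1 / real p ^ (2 * v * k - v))"
definition W3 :: real where
  "W3 = real (p - 1) * real p ^ (2 * m - 2) * (1 - 1 / (real (p - 1) * real p ^ (2 * v * k - v)))"

text \<open>The factor \<open>p ^ 2\<close> clears the denominators, since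
  \<open>2 * m = m + (2 * v * k + v) + (2 * v * k - v)\<close>; it matches the scaling in
  \<open>real_wt_scaled\<close>.\<close>

lemma W_scaled:
  "real p ^ 2 * W1 = (real p - 1) * real p ^ (2 * m)"
  "real p ^ 2 * W2 = (real p - 1) * real p ^ (2 * m) + (real p - 1) * real p ^ m * real p ^ (2 * v * k + v)"
  "real p ^ 2 * W3 = (real p - 1) * real p ^ (2 * m) - real p ^ m * real p ^ (2 * v * k + v)"
proof -
  have p: "real p > 1" using p_gt_1 by simp
  have p1: "real (p - 1) = real p - 1" using p_gt_1 by (simp add: of_nat_diff)
  have vk: "v \<le> 2 * v * k" using k_pos by simp
  show 1: "real p ^ 2 * W1 = (real p - 1) * real p ^ (2 * m)"
  proof -
    have "2 * m = 2 + (2 * m - 2)" using m_pos by simp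
    hence "real p ^ (2 * m) = real p ^ 2 * real p ^ (2 * m - 2)" by (metis power_add)
    thus ?thesis unfolding W1_def p1 by simp
  qed
  have "real p ^ (2 * m) = real p ^ m * real p ^ (2 * v * k + v) * real p ^ (2 * v * k - v)"
  proof -
    have "2 * m = m + (2 * v * k + v) + (2 * v * k - v)" using vk m_eq by linarith
    thus ?thesis by (metis power_add)
  qed
  hence D: "real p ^ (2 * m) / real p ^ (2 * v * k - v) = real p ^ m * real p ^ (2 * v * k + v)"
    using p by simp
  have "W2 = W1 + W1 / real p ^ (2 * v * k - v)"
    unfolding W1_def W2_def by (simp only: distrib_left mult_1_right times_divide_eq_right)
  hence "real p ^ 2 * W2 = real p ^ 2 * W1 + (real p ^ 2 * W1) / real p ^ (2 * v * k - v)"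
    by (simp add: distrib_left)
  also have "\<dots> = (real p - 1) * real p ^ (2 * m) + (real p - 1) * (real p ^ (2 * m) / real p ^ (2 * v * k - v))"
    unfolding 1 by simp
  finally show "real p ^ 2 * W2 = (real p - 1) * real p ^ (2 * m) + (real p - 1) * real p ^ m * real p ^ (2 * v * k + v)"
    unfolding D by simp
  have "W3 = W1 - W1 / (real p - 1) / real p ^ (2 * v * k - v)"
    unfolding W1_def W3_def p1 by (simp add: right_diff_distrib)
  hence "real p ^ 2 * W3 = real p ^ 2 * W1 - (real p ^ 2 * W1) / (real p - 1) / real p ^ (2 * v * k - v)"
    by (simp add: right_diff_distrib)
  also have "\<dots> = (real p - 1) * real p ^ (2 * m) - real p ^ (2 * m) / real p ^ (2 * v * k - v)"
    unfolding 1 using p by simp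
  finally show "real p ^ 2 * W3 = (real p - 1) * real p ^ (2 * m) - real p ^ m * real p ^ (2 * v * k + v)"
    unfolding D .
qed

text \<open>The strict order separates the classes of pairs by weight. Positivity of
  \<open>W3\<close> rests on \<open>2 * v * k + v < m\<close>.\<close>

lemma W_order: "0 < W3" "W3 < W1" "W1 < W2"
proof -
  have "p \<noteq> 2" using odd_p by auto
  hence p: "real p > 1" and p2: "real p - 1 > 1" using p_gt_1 by simp_all
  have e: "2 * v * k + v < m" using v_pos k_pos by (simp add: m_eq) 
  have D: "real p ^ (2 * v * k + v) < real p ^ m" using p e by (intro power_strict_increasing)
  have "real p ^ 2 * W3 > 0"
  proof -
    have "real p ^ m * real p ^ (2 * v * k + v) < real p ^ m * real p ^ m"
      using D p by (intro mult_strict_left_mono) auto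
    also have "\<dots> = 1 * real p ^ (2 * m)" by (simp add: mult_2 power_add)
    also have "\<dots> \<le> (real p - 1) * real p ^ (2 * m)" using p2 by (intro mult_right_mono) auto
    finally show ?thesis by (simp add: W_scaled)
  qed
  thus "0 < W3" using p by (simp add: zero_less_mult_iff)
  have "real p ^ 2 * W3 < real p ^ 2 * W1" using p by (simp add: W_scaled)
  thus "W3 < W1" using p by simp
  have "real p ^ 2 * W1 < real p ^ 2 * W2" using p by (simp add: W_scaled)
  thus "W1 < W2" using p by simp
qed

section \<open>Classes of parameter pairs and their sizes\<close>

definition S2 :: "('a \<times> 'a) set" where "S2 = {(a, b). a \<in> K - {0} \<and> b / a \<in> L ` {c. Q c = 0}}"
definition S3 :: "('a \<times> 'a) set" where "S3 = {(a, b). a \<in> K - {0} \<and> b / a \<in> L ` {c. Q c \<noteq> 0}}"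

text \<open>The difference \<open>c - d\<close> lies in the radical, so \<open>Q\<close> descends to
  the image of \<open>L\<close>. This is what keeps \<open>S2\<close> and \<open>S3\<close>
  disjoint.\<close>

lemma Q_eq_of_L_eq: "L c = L d \<Longrightarrow> Q c = Q d"
  using Q_add_R[of "c - d" d] by (simp add: R_def L_diff)

lemma L_images_disjoint: "L ` {c. Q c = 0} \<inter> L ` {c. Q c \<noteq> 0} = {}"
proof (rule equals0I)
  fix b assume "b \<in> L ` {c. Q c = 0} \<inter> L ` {c. Q c \<noteq> 0}"
  then obtain c d where "b = L c" "Q c = 0" "b = L d" "Q d \<noteq> 0" by blast
  thus False using Q_eq_of_L_eq[of c d] by simp
qed

lemma S2_S3_disjoint: "S2 \<inter> S3 = {}"
  unfolding S2_def S3_def using L_images_disjoint by blast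

lemma real_wt_scaled: "real p ^ 2 * real (wt a b) = real p * real p ^ (2 * m) - real p * real (p * M a b)"
proof -
  have "real (wt a b) = real (card E) - real (M a b)"
    using wt_plus_M[of a b] by linarith
  moreover have "real p * real (card E) = real p ^ (2 * m)"
    using arg_cong[OF card_E, of real] by simp
  ultimately show ?thesis by (simp add: power2_eq_square right_diff_distrib mult.assoc)
qed

lemma wt_eqI:
  assumes "real p * real (p * M a b) = real p * real p ^ (2 * m) - real p ^ 2 * W"
  shows "real (wt a b) = W"
proof -
  have "real p ^ 2 * real (wt a b) = real p ^ 2 * W" unfolding real_wt_scaled assms by simp
  thus ?thesis using p_gt_1 by simp
qed

lemma real_power_2m: "real p ^ (2 * m) = real p ^ m * real p ^ m"
  by (simp add: mult_2 power_add)

text \<open>On \<open>S2\<close> and \<open>S3\<close>, \<open>M_K\<close> and \<open>Z_L\<close>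
  reduce the weight to \<open>N 0\<close> and \<open>N 1\<close>. For every other nonzero pair the
  two linear conditions behave independently and \<open>p ^ 2 * M a b = p ^ (2 * m)\<close>.\<close>

lemma wt_cases:
  "(a, b) = (0, 0) \<Longrightarrow> wt a b = 0"
  "(a, b) \<in> S2 \<Longrightarrow> real (wt a b) = W2"
  "(a, b) \<in> S3 \<Longrightarrow> real (wt a b) = W3"
  "(a, b) \<noteq> (0, 0) \<Longrightarrow> (a, b) \<notin> S2 \<Longrightarrow> (a, b) \<notin> S3 \<Longrightarrow> real (wt a b) = W1"
proof -
  show "wt a b = 0" if "(a, b) = (0, 0)"
    using that wt_plus_M[of 0 0] by (simp add: M_def tr_0)
next
  assume "(a, b) \<in> S2"
  then obtain c where c: "a \<in> K" "a \<noteq> 0" "b / a = L c" "Q c = 0" by (auto simp: S2_def)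
  have N0: "real (p * N 0) = real p ^ m - (real p - 1) * real p ^ (2 * v * k + v)"
    using arg_cong[OF level_card_eqs(2), of real] p_gt_1 by (simp add: of_nat_diff)
  have MN: "real p * real (p * M a b) = real p ^ m * real (p * N 0)"
    using M_K[OF c(1,2), of b] c Z_L[of c] by simp
  show "real (wt a b) = W2"
    by (rule wt_eqI) (simp only: MN N0 W_scaled real_power_2m, simp add: algebra_simps)
next
  assume "(a, b) \<in> S3"
  then obtain c where c: "a \<in> K" "a \<noteq> 0" "b / a = L c" "Q c \<noteq> 0" by (auto simp: S3_def)
  have N1: "real (p * N 1) = real p ^ m + real p ^ (2 * v * k + v)"
    using arg_cong[OF level_card_eqs(1), of real] by simp
  have MN: "real p * real (p * M a b) = real p ^ m * real (p * N 1)"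
    using M_K[OF c(1,2), of b] c Z_L[of c] N_eq_N_1[OF Q_in_K c(4)] by simp
  show "real (wt a b) = W3"
    by (rule wt_eqI) (simp only: MN N1 W_scaled real_power_2m, simp add: algebra_simps)
next
  assume ab: "(a, b) \<noteq> (0, 0)" "(a, b) \<notin> S2" "(a, b) \<notin> S3"
  have "p * (p * M a b) = p ^ (2 * m)"
  proof (cases "a \<in> K - {0}")
    case True
    hence "b / a \<notin> range L" using ab by (auto simp: S2_def S3_def)
    hence "p * Z (b / a) = p ^ m" by (rule Z_not_L)
    moreover have "p * (p * M a b) = p ^ m * (p * Z (b / a))"
      using M_K[of a b] True by simp
    ultimately show ?thesis by (simp add: mult_2 power_add)
  next
    case False
    \<comment> \<open>Either \<open>a\<close> lies outside \<open>K\<close>, or \<open>a = 0\<close>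
      and then \<open>b \<noteq> 0\<close>.\<close>
    hence "p * M a b = card E" using ab M_not_K M_0 by auto
    thus ?thesis using card_E by simp
  qed
  hence "real (p * (p * M a b)) = real p ^ (2 * m)" by simp
  hence "real p * real (p * M a b) = real p ^ (2 * m)" by simp
  thus "real (wt a b) = W1" by (intro wt_eqI) (simp only: W_scaled, simp add: left_diff_distrib)
qed

lemma zero_notin_S: "(0, 0) \<notin> S2" "(0, 0) \<notin> S3"
  by (auto simp: S2_def S3_def)

text \<open>The values \<open>0\<close>, \<open>W3\<close>, \<open>W1\<close>, \<open>W2\<close> are
  distinct and the four classes partition all pairs, so the implications of \<open>wt_cases\<close>
  become equivalences.\<close>

lemma wt_level_sets:
  "{(a, b). wt a b = 0} = {(0, 0)}"
  "{(a, b). real (wt a b) = W1} = UNIV - {(0, 0)} - S2 - S3"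
  "{(a, b). real (wt a b) = W2} = S2"
  "{(a, b). real (wt a b) = W3} = S3"
proof -
  have "(wt a b = 0 \<longleftrightarrow> (a, b) = (0, 0)) \<and>
    (real (wt a b) = W1 \<longleftrightarrow> (a, b) \<noteq> (0, 0) \<and> (a, b) \<notin> S2 \<and> (a, b) \<notin> S3) \<and>
    (real (wt a b) = W2 \<longleftrightarrow> (a, b) \<in> S2) \<and> (real (wt a b) = W3 \<longleftrightarrow> (a, b) \<in> S3)" for a b
  proof -
    consider "(a, b) = (0, 0)" | "(a, b) \<in> S2" | "(a, b) \<in> S3"
      | "(a, b) \<noteq> (0, 0)" "(a, b) \<notin> S2" "(a, b) \<notin> S3" by blast
    thus ?thesis
    proof cases
      case 1
      thus ?thesis using wt_cases(1)[OF 1] zero_notin_S W_order by auto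
    next
      case 2
      thus ?thesis using wt_cases(2)[OF 2] zero_notin_S W_order S2_S3_disjoint by auto
    next
      case 3
      thus ?thesis using wt_cases(3)[OF 3] zero_notin_S W_order S2_S3_disjoint by auto
    next
      case 4
      thus ?thesis using wt_cases(4)[OF 4] W_order by auto
    qed
  qed
  thus "{(a, b). wt a b = 0} = {(0, 0)}"
    "{(a, b). real (wt a b) = W1} = UNIV - {(0, 0)} - S2 - S3"
    "{(a, b). real (wt a b) = W2} = S2"
    "{(a, b). real (wt a b) = W3} = S3" by auto
qed

lemma card_scaled_pairs: "card {(a, b). a \<in> K - {0} \<and> b / a \<in> S} = (p - 1) * card S"
proof -
  have "bij_betw (\<lambda>(a, c). (a, a * c)) ((K - {0}) \<times> S) {(a, b). a \<in> K - {0} \<and> b / a \<in> S}"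
    by (rule bij_betw_byWitness[where f' = "\<lambda>(a, b). (a, b / a)"]) auto
  hence "card {(a, b). a \<in> K - {0} \<and> b / a \<in> S} = card ((K - {0}) \<times> S)"
    using bij_betw_same_card by fastforce
  thus ?thesis using card_K K_0 by (simp add: card_cartesian_product card_Diff_singleton)
qed

text \<open>\<open>L\<close> is \<open>p ^ (2 * v)\<close>-to-one, so the image of the zero level
  set has \<open>N 0 / p ^ (2 * v)\<close> elements and the rest of \<open>range L\<close> comes
  from the nonzero values. Each \<open>b / a\<close> then occurs for \<open>p - 1\<close> choices of
  \<open>a\<close>.\<close>

lemma real_card_S:
  "real (card S2) = real (p - 1) * (real p ^ (m - 2 * v - 1) - real p ^ (2 * v * k - v) + real p ^ (2 * v * k - v - 1))"
  "real (card S3) = real (p - 1) * (real p ^ (2 * v * k - v) + 1) * (real p ^ (2 * v * k - v) - real p ^ (2 * v * k - v - 1))"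
  "real (card S2) + real (card S3) = real (p - 1) * real p ^ (m - 2 * v)"
proof -
  have p: "real p > 1" using p_gt_1 by simp
  \<comment> \<open>The smallest exponent in use. From \<open>k \<ge> 1\<close> and
    \<open>v \<ge> 1\<close> follows \<open>2 * v * k - v \<ge> 1\<close>, so the natural
    subtractions are exact and all other exponents are sums with \<open>t\<close>.\<close>
  define t where "t = 2 * v * k - v - 1"
  have "v * k \<ge> v" using k_pos by simp
  hence t1: "2 * v * k - v = t + 1" and t2: "m - 2 * v = 2 * t + 2" and t3: "m - 2 * v - 1 = 2 * t + 1"
    and t4: "m = 2 * v + 2 * t + 2" and t5: "2 * v * k + v = 2 * v + t + 1"
    using v_pos m_eq unfolding t_def by linarith+
  have c2: "p ^ (2 * v) * card (L ` {c. Q c = 0}) = N 0"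
    unfolding N_def by (rule card_L_image[symmetric]) (auto simp: Q_add_R)
  have c: "p ^ (2 * v) * card (range L) = p ^ m"
    using card_L_image[of UNIV] by (simp add: card_UNIV)
  have "range L = L ` {c. Q c = 0} \<union> L ` {c. Q c \<noteq> 0}" by auto
  hence sum: "card (range L) = card (L ` {c. Q c = 0}) + card (L ` {c. Q c \<noteq> 0})"
    using card_Un_disjoint[OF _ _ L_images_disjoint] by simp
  let ?A = "real (card (L ` {c. Q c = 0}))" and ?B = "real (card (L ` {c. Q c \<noteq> 0}))"
  have N0: "real p * real (N 0) = real p ^ m - (real p - 1) * real p ^ (2 * v * k + v)"
    using arg_cong[OF level_card_eqs(2), of real] p_gt_1 by (simp add: of_nat_diff)
  have "real p ^ (2 * v) * (?A + ?B) = real p ^ (2 * v) * real p ^ (2 * t + 2)"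
    using arg_cong[OF c, of real] unfolding sum by (simp add: t4 power_add mult_ac)
  hence AB: "?A + ?B = real p ^ (2 * t + 2)" using p by simp
  have "real p ^ (2 * v) * (real p * ?A) = real p * real (N 0)"
    using arg_cong[OF c2, of real] by (simp add: mult_ac)
  also have "\<dots> = real p ^ (2 * v) * (real p * (real p ^ (2 * t + 1) - real p ^ (t + 1) + real p ^ t))"
    unfolding N0 by (simp only: t4 t5 power_add) (simp add: algebra_simps power2_eq_square)
  finally have A: "?A = real p ^ (2 * t + 1) - real p ^ (t + 1) + real p ^ t" using p by simp
  have B: "?B = (real p ^ (t + 1) + 1) * (real p ^ (t + 1) - real p ^ t)"
  proof -
    have "real p ^ (2 * t) = real p ^ t * real p ^ t" by (simp add: mult_2 power_add)
    moreover have "?B = real p ^ (2 * t + 2) - (real p ^ (2 * t + 1) - real p ^ (t + 1) + real p ^ t)"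
      using AB A by simp
    ultimately show ?thesis by (simp add: power_add algebra_simps power2_eq_square)
  qed
  have S2: "real (card S2) = real (p - 1) * ?A" and S3: "real (card S3) = real (p - 1) * ?B"
    unfolding S2_def S3_def by (simp_all only: card_scaled_pairs of_nat_mult)
  show "real (card S2) = real (p - 1) * (real p ^ (m - 2 * v - 1) - real p ^ (2 * v * k - v) + real p ^ (2 * v * k - v - 1))"
    unfolding S2 A t1 t3 by simp
  show "real (card S3) = real (p - 1) * (real p ^ (2 * v * k - v) + 1) * (real p ^ (2 * v * k - v) - real p ^ (2 * v * k - v - 1))"
    unfolding S3 B t1 by simp
  show "real (card S2) + real (card S3) = real (p - 1) * real p ^ (m - 2 * v)"
    unfolding S2 S3 t2 AB[symmetric] by (simp add: algebra_simps)
qed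

lemma card_S1: "real (card (UNIV - {(0, 0)} - S2 - S3)) = real p ^ (2 * m) - 1 - real (p - 1) * real p ^ (m - 2 * v)"
proof -
  have "card (UNIV :: ('a \<times> 'a) set) = card (insert (0, 0) (S2 \<union> S3)) + card (- insert (0, 0) (S2 \<union> S3))"
    by (subst card_Un_disjoint[symmetric]) auto
  also have "card (insert (0, 0) (S2 \<union> S3)) = 1 + card S2 + card S3"
    using zero_notin_S S2_S3_disjoint by (simp add: card_Un_disjoint)
  also have "- insert (0, 0) (S2 \<union> S3) = UNIV - {(0, 0)} - S2 - S3" by auto
  also have "card (UNIV :: ('a \<times> 'a) set) = p ^ (2 * m)"
    by (simp add: card_UNIV mult_2 power_add flip: UNIV_Times_UNIV)
  finally have "real (p ^ (2 * m)) = real (1 + card S2 + card S3 + card (UNIV - {(0, 0)} - S2 - S3))"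
    by (simp only:)
  thus ?thesis using real_card_S(3) by simp
qed

section \<open>From parameter pairs to codewords\<close>

lemma inj_cw: "inj (\<lambda>(a, b). cw p m u (a::'a) b)"
proof (rule injI, clarify)
  fix a b a' b' :: 'a
  assume eq: "cw p m u a b = cw p m u a' b'"
  \<comment> \<open>Equal codewords have a difference of weight zero, and by
    \<open>wt_level_sets\<close> only the pair \<open>(0, 0)\<close> has that weight.\<close>
  have "cw p m u (a - a') (b - b') z = cw p m u a b z - cw p m u a' b' z" for z
  proof (cases z)
    case (Pair x y)
    have "(a - a') * x + (b - b') * y = (a * x + b * y) - (a' * x + b' * y)"
      by (simp add: algebra_simps)
    thus ?thesis by (simp add: Pair cw_def tr_diff)
  qed
  hence "wt (a - a') (b - b') = 0" by (simp add: wt_def hwt_def eq)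
  hence "(a - a', b - b') \<in> {(a, b). wt a b = 0}" by simp
  thus "a = a' \<and> b = b'" unfolding wt_level_sets by simp
qed

lemma code_eq: "code p m u = (\<lambda>(a, b). cw p m u (a::'a) b) ` UNIV"
  by (auto simp: code_def)

lemma card_code: "card (code p m u :: ('a \<times> 'a \<Rightarrow> 'a) set) = p ^ (2 * m)"
  unfolding code_eq by (subst card_image[OF inj_cw])
    (simp add: card_UNIV mult_2 power_add flip: UNIV_Times_UNIV)

text \<open>Distinct pairs give distinct codewords, so multiplicities may be counted on
  pairs.\<close>

lemma wmult_eq: "wmult p m u TYPE('a) n = card {(a, b). wt a b = n}"
proof -
  have "{c \<in> (code p m u :: ('a \<times> 'a \<Rightarrow> 'a) set). hwt p m u c = n}
      = (\<lambda>(a, b). cw p m u a b) ` {(a, b). wt a b = n}"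
    unfolding code_eq by (auto simp: wt_def)
  moreover have "inj_on (\<lambda>(a, b). cw p m u (a::'a) b) {(a, b). wt a b = n}"
    using inj_cw by (rule inj_on_subset) simp
  ultimately show ?thesis by (simp only: wmult_def card_image)
qed

lemma S_nonempty: "(0, 1) \<in> UNIV - {(0, 0)} - S2 - S3" "S2 \<noteq> {}" "S3 \<noteq> {}"
proof -
  show "(0, 1) \<in> UNIV - {(0, 0)} - S2 - S3" by (auto simp: S2_def S3_def)
  have "(1, L 0) \<in> S2" using K_1 Q_R zero_in_R by (auto simp: S2_def)
  thus "S2 \<noteq> {}" by auto
  have "N 1 \<noteq> 0" using level_card_eqs(1) p_gt_1 by (intro notI) simp
  then obtain c where "Q c = 1" unfolding N_def by (metis (mono_tags, lifting) card.empty empty_Collect_eq)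
  hence "(1, L c) \<in> S3" using K_1 by (auto simp: S3_def)
  thus "S3 \<noteq> {}" by auto
qed

text \<open>Nonemptiness of the three classes shows that all three values are attained; in
  particular \<open>W1\<close>, \<open>W2\<close> and \<open>W3\<close> are natural numbers.\<close>

lemma nonzero_weights:
  "{n. n \<noteq> 0 \<and> (\<exists>c \<in> (code p m u :: ('a \<times> 'a \<Rightarrow> 'a) set). hwt p m u c = n)}
    = {n. real n = W1 \<or> real n = W2 \<or> real n = W3}" (is "?X = ?Y")
  "card {n. real n = W1 \<or> real n = W2 \<or> real n = W3} = 3"
proof -
  obtain a2 b2 a3 b3 where "(a2, b2) \<in> S2" "(a3, b3) \<in> S3" using S_nonempty(2,3) by force
  hence ab: "real (wt 0 1) = W1" "real (wt a2 b2) = W2" "real (wt a3 b3) = W3"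
    using S_nonempty(1) wt_cases(2,3) wt_cases(4)[of 0 1] by simp_all
  have "?X = {n. n \<noteq> 0 \<and> (\<exists>a b. wt a b = n)}" unfolding code_eq by (auto simp: wt_def)
  also have "\<dots> = ?Y"
  proof (intro equalityI subsetI)
    fix n assume "n \<in> {n. n \<noteq> 0 \<and> (\<exists>a b. wt a b = n)}"
    then obtain a b where "n = wt a b" "wt a b \<noteq> 0" by auto
    thus "n \<in> ?Y" using wt_cases[of a b] by (cases "(a, b) \<in> S2"; cases "(a, b) \<in> S3"; cases "(a, b) = (0, 0)") auto
  next
    fix n assume "n \<in> ?Y"
    hence "n > 0" "n = wt 0 1 \<or> n = wt a2 b2 \<or> n = wt a3 b3" using ab W_order by auto
    thus "n \<in> {n. n \<noteq> 0 \<and> (\<exists>a b. wt a b = n)}" by auto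
  qed
  finally show "?X = ?Y" .
  have "?Y = {wt 0 1, wt a2 b2, wt a3 b3}"
    using ab by (auto simp flip: of_nat_eq_iff[where 'a = real])
  moreover have "wt 0 1 \<noteq> wt a2 b2" "wt 0 1 \<noteq> wt a3 b3" "wt a2 b2 \<noteq> wt a3 b3"
    using ab W_order by (auto simp flip: of_nat_eq_iff[where 'a = real])
  ultimately show "card ?Y = 3" by simp
qed

lemma card_D1: "card (D1 p m u :: ('a \<times> 'a) set) = p ^ (2 * m - 1) - 1"
proof -
  have "card E = Suc (card (D1 p m u :: ('a \<times> 'a) set))" using zero_notin_D1 by (simp add: E_eq)
  moreover have "p * card E = p * p ^ (2 * m - 1)"
    using card_E m_pos by (simp flip: power_Suc)
  hence "card E = p ^ (2 * m - 1)" using p_gt_1 by simp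
  ultimately show ?thesis by simp
qed

lemma wmult_W:
  "wmult p m u TYPE('a) 0 = 1"
  "real n = W1 \<Longrightarrow> wmult p m u TYPE('a) n = card (UNIV - {(0, 0)} - S2 - S3)"
  "real n = W2 \<Longrightarrow> wmult p m u TYPE('a) n = card S2"
  "real n = W3 \<Longrightarrow> wmult p m u TYPE('a) n = card S3"
proof -
  have *: "{(a, b). wt a b = n} = {(a, b). real (wt a b) = real n}" by auto
  show "wmult p m u TYPE('a) 0 = 1" by (simp add: wmult_eq wt_level_sets)
  show "real n = W1 \<Longrightarrow> wmult p m u TYPE('a) n = card (UNIV - {(0, 0)} - S2 - S3)"
    "real n = W2 \<Longrightarrow> wmult p m u TYPE('a) n = card S2"
    "real n = W3 \<Longrightarrow> wmult p m u TYPE('a) n = card S3"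
    unfolding wmult_eq * by (simp_all only: wt_level_sets)
qed

end

theorem theorem4:
  fixes p m u :: nat
  assumes "prime p" and "odd p"
    and "m > 0" and "even m"
    and "u > 0"
    and "card (UNIV :: ('a::{field,finite}) set) = p ^ m" and "CHAR('a) = p"
    and "(m div gcd m u) mod 4 = 0"
  defines "v \<equiv> gcd m u"
    and "s \<equiv> m div 2"
  shows
    "card (D1 p m u :: ('a \<times> 'a) set) = p ^ (2*m - 1) - 1
     \<and> card (code p m u :: ('a \<times> 'a \<Rightarrow> 'a) set) = p ^ (2*m)
     \<and> card {w. w \<noteq> 0 \<and> (\<exists>c \<in> (code p m u :: ('a \<times> 'a \<Rightarrow> 'a) set). hwt p m u c = w)} = 3
     \<and> {w. w \<noteq> 0 \<and> (\<exists>c \<in> (code p m u :: ('a \<times> 'a \<Rightarrow> 'a) set). hwt p m u c = w)}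
         = {w. real w = real (p-1) * real p ^ (2*m-2)
             \<or> real w = real (p-1) * real p ^ (2*m-2) * (1 + 1 / real p ^ (s-v))
             \<or> real w = real (p-1) * real p ^ (2*m-2) * (1 - 1 / (real (p-1) * real p ^ (s-v)))}
     \<and> wmult p m u TYPE('a) 0 = 1
     \<and> (\<forall>w. real w = real (p-1) * real p ^ (2*m-2) \<longrightarrow>
           real (wmult p m u TYPE('a) w) = real p ^ (2*m) - 1 - real (p-1) * real p ^ (m - 2*v))
     \<and> (\<forall>w. real w = real (p-1) * real p ^ (2*m-2) * (1 + 1 / real p ^ (s-v)) \<longrightarrow>
           real (wmult p m u TYPE('a) w) =
             real (p-1) * (real p ^ (m - 2*v - 1) - real p ^ (s-v) + real p ^ (s-v-1)))
     \<and> (\<forall>w. real w = real (p-1) * real p ^ (2*m-2) * (1 - 1 / (real (p-1) * real p ^ (s-v))) \<longrightarrow>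
           real (wmult p m u TYPE('a) w) =
             real (p-1) * (real p ^ (s-v) + 1) * (real p ^ (s-v) - real p ^ (s-v-1)))"
proof -
  \<comment> \<open>The parameters of \<open>gold_form\<close>: \<open>m / v = 4 * k\<close> and
    \<open>u / v = w\<close>.\<close>
  define k w where "k = m div v div 4" and "w = u div v"
  have v_pos: "v > 0" using \<open>u > 0\<close> by (simp add: v_def)
  have "v dvd m" "v dvd u" by (simp_all add: v_def)
  have mv: "m div v = 4 * k" using assms(8) by (auto simp: v_def k_def)
  have m_eq: "m = 4 * v * k"
    using dvd_mult_div_cancel[OF \<open>v dvd m\<close>] by (simp add: mv mult_ac)
  have u_eq: "u = v * w" using \<open>v dvd u\<close> by (simp add: w_def)
  have "coprime (m div v) w"
    unfolding v_def w_def using \<open>u > 0\<close> by (intro div_gcd_coprime) auto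
  \<comment> \<open>Writing \<open>4 * k\<close> as \<open>2 * (2 * k)\<close> lets one coprimality
    fact split into \<open>odd w\<close> and \<open>coprime (2 * k) w\<close>.\<close>
  hence cop: "coprime (2 * (2 * k)) w" by (simp add: mv)
  interpret gold_form p m "TYPE('a)" u v k w
  proof unfold_locales
    show "k > 0" using m_eq \<open>m > 0\<close> by (auto intro!: Nat.gr0I)
    show "coprime (2 * k) w" using cop by (simp only: coprime_mult_left_iff)
    show "odd w" using cop unfolding coprime_mult_left_iff by simp
  qed (fact assms v_pos m_eq u_eq)+
  have s: "s = 2 * v * k" by (simp add: s_def m_eq)
  show ?thesis
    \<comment> \<open>\<open>W2\<close> and \<open>W3\<close> are folded before \<open>W1\<close>,
      because the body of \<open>W1\<close> is a subterm of theirs.\<close>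
    unfolding s unfolding W2_def[symmetric] W3_def[symmetric] unfolding W1_def[symmetric]
    by (intro conjI allI impI)
      (simp_all only: card_D1 card_code nonzero_weights wmult_W real_card_S(1,2) card_S1)
qed

end
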